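(* Let $\mathfrak{A}$ be a $C^*$-algebra, let $(\mathcal{H},\pi)$ be a nonzero irreducible representation of $\mathfrak{A}$, and let $n$ be a positive integer. Let $$X=\{(\mathbf{x},\mathbf{y})\in\mathcal{H}^{2n} : x_1,\ldots,x_n \text{ are linearly independent}\},$$ equipped with the subspace topology inherited from $\mathcal{H}^{2n}$. Then there exists a continuous map $A:X\to\mathfrak{A}$ such that $$\pi(A(\mathbf{x},\mathbf{y}))x_i=y_i\quad\text{for all } i=1,\ldots,n$$ for all $(\mathbf{x},\mathbf{y})\in X$. Similarly, defining $$X_{\mathrm{sa}}=\{(\mathbf{x},\mathbf{y})\in X : \text{there exists a self-adjoint } T\in\mathfrak{B}(\mathcal{H}) \text{ such that } Tx_i=y_i \text{ for all } i=1,\ldots,n\},$$ there exists a continuous map $A:X_{\mathrm{sa}}\to\mathfrak{A}_{\mathrm{sa}}$ such that $\pi(A(\mathbf{x},\mathbf{y}))x_i=y_i$ for all $i=1,\ldots,n$ and all $(\mathbf{x},\mathbf{y})\in X_{\mathrm{sa}}$.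
   Context: Hilbert spaces are complex. $\mathfrak{B}(\mathcal{H})$ is the algebra of bounded operators on $\mathcal{H}$. Bold letters denote $n$-tuples $\mathbf{x}=(x_1,\ldots,x_n)\in\mathcal{H}^n$, and elements of $\mathcal{H}^{2n}$ are written as pairs $(\mathbf{x},\mathbf{y})$ of $n$-tuples. $\mathcal{H}^{2n}$ carries its Hilbert space norm topology, $\mathfrak{A}$ its norm topology, and $\mathfrak{A}_{\mathrm{sa}}$ is the set of self-adjoint elements of $\mathfrak{A}$ with the subspace topology ($X_{\mathrm{sa}}$ also carries the subspace topology). The $C^*$-algebra need not be unital. *)

theory Defs
  imports "HOL-Analysis.Analysis"
begin

section \<open>Complex vector spaces\<close>

class complex_vector = real_vector +
  fixes scaleC :: "complex \<Rightarrow> 'a \<Rightarrow> 'a" (infixr \<open>*\<^sub>C\<close> 75)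
  assumes scaleC_add_right: "c *\<^sub>C (x + y) = c *\<^sub>C x + c *\<^sub>C y"
    and scaleC_add_left: "(c + d) *\<^sub>C x = c *\<^sub>C x + d *\<^sub>C x"
    and scaleC_scaleC: "c *\<^sub>C d *\<^sub>C x = (c * d) *\<^sub>C x"
    and scaleC_of_real: "complex_of_real r *\<^sub>C x = r *\<^sub>R x"

global_interpretation complex_vector: vector_space "scaleC :: complex \<Rightarrow> 'a \<Rightarrow> 'a::complex_vector"
proof
  show "1 *\<^sub>C x = x" for x :: 'a
    using scaleC_of_real[of 1 x] by simp
qed (simp_all add: scaleC_add_right scaleC_add_left scaleC_scaleC)

definition clin_indep :: "'h::complex_vector ^ 'n \<Rightarrow> bool" where
  \<comment> \<open>Independence of a family, not of its set of values: repeated entries are excluded.\<close>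
  "clin_indep x \<longleftrightarrow>
     inj (\<lambda>i. x $ i) \<and> complex_vector.independent (range (\<lambda>i. x $ i))"


section \<open>Hilbert spaces and bounded operators\<close>

text \<open>The inner product is linear in the first argument.\<close>

class complex_inner = complex_vector + real_normed_vector +
  fixes cinner :: "'a \<Rightarrow> 'a \<Rightarrow> complex"
  assumes cinner_commute: "cinner x y = cnj (cinner y x)"
    and cinner_add_left: "cinner (x + y) z = cinner x z + cinner y z"
    and cinner_scaleC_left: "cinner (c *\<^sub>C x) y = c * cinner x y"
    and cinner_self_nonneg: "0 \<le> Re (cinner x x)"
    and cinner_self_eq_zero_iff: "cinner x x = 0 \<longleftrightarrow> x = 0"
    and norm_eq_sqrt_cinner: "norm x = sqrt (Re (cinner x x))"

class chilbert_space = complex_inner + banach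

definition bounded_clinear :: "('h::chilbert_space \<Rightarrow> 'h) \<Rightarrow> bool" where
  "bounded_clinear T \<longleftrightarrow>
     Vector_Spaces.linear scaleC scaleC T \<and> (\<exists>K. \<forall>x. norm (T x) \<le> K * norm x)"

definition selfadjoint_op :: "('h::chilbert_space \<Rightarrow> 'h) \<Rightarrow> bool" where
  "selfadjoint_op T \<longleftrightarrow>
     bounded_clinear T \<and> (\<forall>x y. cinner (T x) y = cinner x (T y))"


section \<open>C*-algebras and their representations\<close>

text \<open>The class \<^class>\<open>real_normed_algebra\<close> supplies an associative product with
  submultiplicative norm and no unit.\<close>

class cstar_algebra = complex_vector + real_normed_algebra + banach +
  fixes star :: "'a \<Rightarrow> 'a"
  assumes mult_scaleC_left: "(c *\<^sub>C a) * b = c *\<^sub>C (a * b)"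
    and mult_scaleC_right: "a * (c *\<^sub>C b) = c *\<^sub>C (a * b)"
    and norm_scaleC: "norm (c *\<^sub>C a) = cmod c * norm a"
    and star_star: "star (star a) = a"
    and star_add: "star (a + b) = star a + star b"
    and star_scaleC: "star (c *\<^sub>C a) = cnj c *\<^sub>C star a"
    and star_mult: "star (a * b) = star b * star a"
    and cstar_identity: "norm (star a * a) = (norm a)\<^sup>2"

definition selfadjoint_elements :: "'a::cstar_algebra set" where
  "selfadjoint_elements = {a. star a = a}"

text \<open>Norm continuity of \<open>\<pi>\<close> is automatic, so it is not assumed.\<close>

locale cstar_representation =
  fixes \<pi> :: "'a::cstar_algebra \<Rightarrow> 'h::chilbert_space \<Rightarrow> 'h"
  assumes rep_bounded: "bounded_clinear (\<pi> a)"
    and rep_add: "\<pi> (a + b) x = \<pi> a x + \<pi> b x"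
    and rep_scaleC: "\<pi> (c *\<^sub>C a) x = c *\<^sub>C \<pi> a x"
    and rep_mult: "\<pi> (a * b) x = \<pi> a (\<pi> b x)"
    and rep_star: "cinner (\<pi> (star a) x) y = cinner x (\<pi> a y)"

locale irreducible_representation = cstar_representation +
  assumes irreducible:
    "\<lbrakk>complex_vector.subspace M; closed M; \<And>a. \<pi> a ` M \<subseteq> M\<rbrakk> \<Longrightarrow> M = {0} \<or> M = UNIV"


section \<open>The spaces of interpolation data\<close>

text \<open>Here \<^typ>\<open>'n\<close> is the index set of the tuples. The norm of
  \<^typ>\<open>('h ^ 'n) \<times> ('h ^ 'n)\<close> is the Hilbert space norm of the direct sum.\<close>

definition interp_data :: "(('h::chilbert_space ^ 'n) \<times> ('h ^ 'n)) set" where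
  "interp_data = {(x, y). clin_indep x}"

definition interp_data_sa :: "(('h::chilbert_space ^ 'n) \<times> ('h ^ 'n)) set" where
  "interp_data_sa =
     {(x, y) \<in> interp_data. \<exists>T. selfadjoint_op T \<and> (\<forall>i. T (x $ i) = y $ i)}"

end

theory Submission imports Defs begin

text \<open>
  Write \<open>\<Phi>\<^sub>x(a) = (\<pi>(a) x\<^sub>i)\<^sub>i\<close>. The theorem asks for a solution \<open>a\<close> of \<open>\<Phi>\<^sub>x(a) = y\<close> that depends continuously on
  \<open>(x, y)\<close>. The solutions form a convex set, so continuous solutions may be glued by a partition
  of unity, and by the usual iteration on the error it suffices to find approximate solutions with a
  norm bound that is linear in \<open>y\<close> and locally uniform in \<open>x\<close>. This reduces the theorem to a
  quantitative form of Kadison's transitivity theorem.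

  Every finite-rank operator is a combination of the projections onto lines, with coefficients controlled by the
  norms of the vectors involved. So it is enough to approximate the projection onto a unit vector \<open>u\<close>
  on finitely many vectors by \<open>\<pi>(a)\<close> with \<open>a\<close> self-adjoint and \<open>norm a \<le> 1\<close>
  (\<open>approx_projection_unit\<close>). The density theorem (\<open>selfadjoint_density\<close>) provides a self-adjoint
  \<open>s\<close> such that \<open>\<pi>(s)\<close> almost fixes \<open>u\<close> and almost annihilates given vectors orthogonal to \<open>u\<close>, but
  without any control of its norm. As these vectors are approximate
  eigenvectors for the eigenvalues \<open>1\<close> and \<open>0\<close>, the element \<open>s\<close> may be replaced by \<open>f(s)\<close> for a
  bounded Lipschitz function \<open>f\<close> with \<open>f(0) = 0\<close> and \<open>f(1) = 1\<close> (\<open>bounded_cutoff\<close>); this is the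
  mechanism of Kaplansky's density theorem. A suitable \<open>f\<close> is a cosine, obtained from powers of a
  unitary.

  The density theorem rests on Schur's lemma (\<open>commutant_scalar\<close>): the projection onto the closure
  of the range of \<open>\<Phi>\<^sub>x\<close> is a matrix of operators in the commutant, hence of scalars. Schur's lemma, the
  contractivity of representations and the unitary in \<open>bounded_cutoff\<close> are
  all consequences of one elementary fact, the existence of \<open>\<surd>(1 - b)\<close> for \<open>norm b \<le> 1\<close>
  (\<open>quadratic_fixpoint\<close>).

  For self-adjoint data the finite-rank operator that maps \<open>x\<close> to \<open>y\<close> must itself be symmetric
  (\<open>symmetric_interpolation\<close>); everything else is the same. The gluing argument works in an arbitrary metric space
  (\<open>glue_convex_selections\<close>), which matters because the Hilbert space need not be separable.
\<close>


section \<open>Complex inner products\<close>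

lemma scaleC_scaleR_commute: "c *\<^sub>C r *\<^sub>R x = r *\<^sub>R c *\<^sub>C (x :: 'a::complex_vector)"
  by (simp flip: scaleC_of_real add: scaleC_scaleC mult.commute)

lemma cinner_add_right: "cinner x (y + z) = cinner x y + cinner x (z :: 'a::complex_inner)"
  by (metis cinner_add_left cinner_commute complex_cnj_add)

lemma cinner_scaleC_right: "cinner x (c *\<^sub>C y) = cnj c * cinner x (y :: 'a::complex_inner)"
  by (metis cinner_commute cinner_scaleC_left complex_cnj_mult)

lemma cinner_scaleR_left: "cinner (r *\<^sub>R x) y = of_real r * cinner x (y :: 'a::complex_inner)"
  by (metis cinner_scaleC_left scaleC_of_real)

lemma cinner_scaleR_right: "cinner x (r *\<^sub>R y) = of_real r * cinner x (y :: 'a::complex_inner)"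
  by (metis cinner_scaleC_right scaleC_of_real complex_cnj_complex_of_real)

lemma cinner_zero_left [simp]: "cinner 0 (y :: 'a::complex_inner) = 0"
  using cinner_scaleR_left[of 0 0 y] by simp

lemma cinner_zero_right [simp]: "cinner (y :: 'a::complex_inner) 0 = 0"
  using cinner_scaleR_right[of y 0 0] by simp

lemma cinner_minus_left: "cinner (- x) y = - cinner x (y :: 'a::complex_inner)"
  using cinner_scaleR_left[of "-1" x y] by simp

lemma cinner_minus_right: "cinner x (- y) = - cinner x (y :: 'a::complex_inner)"
  using cinner_scaleR_right[of x "-1" y] by simp

lemma cinner_diff_left: "cinner (x - z) y = cinner x y - cinner z (y :: 'a::complex_inner)"
  using cinner_add_left[of x "- z" y] by (simp add: cinner_minus_left)

lemma cinner_diff_right: "cinner x (y - z) = cinner x y - cinner x (z :: 'a::complex_inner)"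
  using cinner_add_right[of x y "- z"] by (simp add: cinner_minus_right)

lemma cinner_sum_left: "cinner (\<Sum>i\<in>A. f i) y = (\<Sum>i\<in>A. cinner (f i) (y :: 'a::complex_inner))"
  by (induction A rule: infinite_finite_induct) (auto simp: cinner_add_left)

lemma cinner_sum_right: "cinner y (\<Sum>i\<in>A. f i) = (\<Sum>i\<in>A. cinner (y :: 'a::complex_inner) (f i))"
  by (induction A rule: infinite_finite_induct) (auto simp: cinner_add_right)

lemmas cinner_algebra = cinner_add_left cinner_add_right cinner_diff_left cinner_diff_right
  cinner_minus_left cinner_minus_right cinner_scaleR_left cinner_scaleR_right
  cinner_scaleC_left cinner_scaleC_right

lemma cinner_self: "cinner x x = complex_of_real ((norm (x :: 'a::complex_inner))\<^sup>2)"
proof -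
  have "Im (cinner x x) = 0"
    using cinner_commute[of x x] by (metis cnj.simps(2) neg_equal_zero)
  then show ?thesis
    by (simp add: complex_eq_iff norm_eq_sqrt_cinner cinner_self_nonneg)
qed

lemma norm_sq_cinner: "(norm (x :: 'a::complex_inner))\<^sup>2 = Re (cinner x x)"
  by (simp add: cinner_self)

lemma Re_cinner_commute: "Re (cinner x y) = Re (cinner y (x :: 'a::complex_inner))"
  by (metis cinner_commute cnj.simps(1))

lemma norm_diff_sq: "(norm (x - y))\<^sup>2 = (norm x)\<^sup>2 - 2 * Re (cinner x y) + (norm (y :: 'a::complex_inner))\<^sup>2"
  using Re_cinner_commute[of x y] by (simp add: norm_sq_cinner cinner_algebra)

lemma norm_add_sq: "(norm (x + y))\<^sup>2 = (norm x)\<^sup>2 + 2 * Re (cinner x y) + (norm (y :: 'a::complex_inner))\<^sup>2"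
  using Re_cinner_commute[of x y] by (simp add: norm_sq_cinner cinner_algebra)

lemma parallelogram:
  "(norm (x + y))\<^sup>2 + (norm (x - y))\<^sup>2 = 2 * (norm x)\<^sup>2 + 2 * (norm (y :: 'a::complex_inner))\<^sup>2"
  by (simp add: norm_diff_sq norm_add_sq)

lemma norm_scaleC_inner: "norm (c *\<^sub>C (x :: 'a::complex_inner)) = cmod c * norm x"
proof -
  have "(norm (c *\<^sub>C x))\<^sup>2 = Re (c * cnj c * cinner x x)"
    by (simp only: norm_sq_cinner cinner_scaleC_left cinner_scaleC_right ac_simps)
  also have "\<dots> = (cmod c * norm x)\<^sup>2"
    by (simp add: cinner_self power_mult_distrib flip: complex_norm_square of_real_mult of_real_power)
  finally show ?thesis
    by (simp add: power2_eq_iff_nonneg)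
qed

lemma Cauchy_Schwarz: "cmod (cinner x y) \<le> norm x * norm (y :: 'a::complex_inner)"
proof (cases "y = 0")
  case False
  define c where "c = cinner x y / of_real ((norm y)\<^sup>2)"
  have "0 \<le> (norm (x - c *\<^sub>C y))\<^sup>2" by simp
  also have "\<dots> = (norm x)\<^sup>2 - 2 * Re (cnj c * cinner x y) + (cmod c)\<^sup>2 * (norm y)\<^sup>2"
    by (simp add: norm_diff_sq cinner_scaleC_right norm_scaleC_inner power_mult_distrib)
  also have "cnj c * cinner x y = of_real ((cmod (cinner x y))\<^sup>2 / (norm y)\<^sup>2)"
    unfolding c_def by (simp add: mult.commute[of "cnj _"] flip: complex_norm_square)
  also have "cmod c = cmod (cinner x y) / (norm y)\<^sup>2"
    by (simp add: c_def norm_divide norm_power)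
  also have "(cmod (cinner x y) / (norm y)\<^sup>2)\<^sup>2 * (norm y)\<^sup>2 = (cmod (cinner x y))\<^sup>2 / (norm y)\<^sup>2"
    using False by (simp add: power_divide field_simps power2_eq_square)
  finally have "(cmod (cinner x y))\<^sup>2 / (norm y)\<^sup>2 \<le> (norm x)\<^sup>2"
    by simp
  then have "(cmod (cinner x y))\<^sup>2 \<le> (norm x * norm y)\<^sup>2"
    using False by (simp add: field_simps power_mult_distrib)
  then show ?thesis
    by (simp add: power2_le_iff_abs_le abs_le_square_iff)
qed simp

lemma bounded_linear_scaleC: "bounded_linear (\<lambda>x. c *\<^sub>C (x :: 'a::complex_inner))"
  by (rule bounded_linear_intro[where K = "cmod c"])
     (simp_all add: scaleC_add_right scaleC_scaleR_commute norm_scaleC_inner)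

lemma bounded_bilinear_cinner: "bounded_bilinear (cinner :: 'a::complex_inner \<Rightarrow> 'a \<Rightarrow> complex)"
proof
  show "\<exists>K. \<forall>a b. cmod (cinner (a :: 'a) b) \<le> norm a * norm b * K"
    by (intro exI[of _ 1]) (simp add: Cauchy_Schwarz)
qed (simp_all add: cinner_algebra scaleR_conv_of_real)

lemmas continuous_on_cinner [continuous_intros] =
  bounded_bilinear.continuous_on[OF bounded_bilinear_cinner]

lemmas continuous_on_scaleC_const [continuous_intros] =
  bounded_linear.continuous_on[OF bounded_linear_scaleC]

text \<open>Over the complex numbers the quadratic form determines the operator: replacing
  \<open>y\<close> by \<open>\<i> y\<close> separates the two cross terms of \<open>q(x + y)\<close>.\<close>

lemma quadratic_form_zero_imp_zero:
  fixes T :: "'a::complex_inner \<Rightarrow> 'a"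
  assumes add: "\<And>x y. T (x + y) = T x + T y"
    and scale: "\<And>c x. T (c *\<^sub>C x) = c *\<^sub>C T x"
    and zero: "\<And>x. cinner (T x) x = 0"
  shows "T x = 0"
proof -
  have 1: "cinner (T x) y + cinner (T y) x = 0" for x y
    using zero[of "x + y"] zero[of x] zero[of y] by (simp add: add cinner_algebra add.commute)
  have "cinner (T x) y = 0" for y
    using 1[of x y] 1[of x "\<i> *\<^sub>C y"] by (simp add: scale cinner_algebra algebra_simps)
  then show ?thesis
    using cinner_self_eq_zero_iff by blast
qed


section \<open>Tuples of vectors as a Hilbert space\<close>

instantiation vec :: (complex_vector, finite) complex_vector
begin

definition scaleC_vec :: "complex \<Rightarrow> 'a ^ 'b \<Rightarrow> 'a ^ 'b"
  where "scaleC_vec c x = (\<chi> i. c *\<^sub>C (x $ i))"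

instance
  by standard (simp_all add: scaleC_vec_def vec_eq_iff scaleC_add_right scaleC_add_left
      scaleC_scaleC scaleC_of_real)

end

lemma scaleC_vec_nth [simp]: "(c *\<^sub>C x) $ i = c *\<^sub>C (x $ i)"
  by (simp add: scaleC_vec_def)

instantiation vec :: (complex_inner, finite) complex_inner
begin

definition cinner_vec :: "'a ^ 'b \<Rightarrow> 'a ^ 'b \<Rightarrow> complex"
  where "cinner_vec x y = (\<Sum>i\<in>UNIV. cinner (x $ i) (y $ i))"

instance
proof
  fix x y z :: "'a ^ 'b" and c :: complex
  have *: "cinner x x = complex_of_real (\<Sum>i\<in>UNIV. (norm (x $ i))\<^sup>2)"
    by (simp add: cinner_vec_def cinner_self)
  show "cinner x y = cnj (cinner y x)"
    by (simp add: cinner_vec_def) (meson cinner_commute)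
  show "cinner (x + y) z = cinner x z + cinner y z"
    by (simp add: cinner_vec_def cinner_add_left sum.distrib)
  show "cinner (c *\<^sub>C x) y = c * cinner x y"
    by (simp add: cinner_vec_def cinner_scaleC_left sum_distrib_left)
  show "0 \<le> Re (cinner x x)"
    unfolding * by (simp add: sum_nonneg)
  show "cinner x x = 0 \<longleftrightarrow> x = 0"
    unfolding * by (simp add: sum_nonneg_eq_0_iff vec_eq_iff flip: of_real_sum)
  show "norm x = sqrt (Re (cinner x x))"
    unfolding * by (simp add: norm_vec_def L2_set_def)
qed

end

instance vec :: (chilbert_space, finite) chilbert_space ..

lemma norm_vec_le_card:
  fixes x :: "'a::real_normed_vector ^ 'n::finite"
  assumes "\<And>i. norm (x $ i) \<le> c"
  shows "norm x \<le> real CARD('n) * c"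
proof -
  have "norm x \<le> (\<Sum>i\<in>UNIV. norm (x $ i))"
    unfolding norm_vec_def by (rule L2_set_le_sum) simp
  also have "\<dots> \<le> (\<Sum>i\<in>(UNIV::'n set). c)"
    by (intro sum_mono assms)
  finally show ?thesis by simp
qed


section \<open>Orthogonal projections\<close>

text \<open>The parallelogram law makes every minimizing sequence for the distance to a closed
  subspace a Cauchy sequence; the limit is the foot of the perpendicular.\<close>

lemma orthogonal_foot_exists:
  fixes M :: "'a::chilbert_space set"
  assumes sub: "subspace M" and "closed M"
  shows "\<exists>q\<in>M. \<forall>m\<in>M. Re (cinner (y - q) m) = 0"
proof -
  define \<delta> where "\<delta> = infdist y M"
  have ne: "M \<noteq> {}" using sub subspace_0 by auto
  have \<delta>: "\<delta> \<le> norm (y - m)" if "m \<in> M" for m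
    using infdist_le[OF that, of y] by (simp add: \<delta>_def dist_norm)
  have \<delta>0: "0 \<le> \<delta>" by (simp add: \<delta>_def infdist_nonneg)
  have "\<exists>m\<in>M. norm (y - m) < \<delta> + 1 / Suc k" for k
  proof -
    have "infdist y M < \<delta> + 1 / Suc k" by (simp add: \<delta>_def)
    then show ?thesis
      unfolding infdist_notempty[OF ne]
      by (subst (asm) cINF_less_iff) (auto simp: ne dist_norm intro!: bdd_belowI2[of _ 0])
  qed
  then obtain f where f: "\<And>k. f k \<in> M" "\<And>k. norm (y - f k) < \<delta> + 1 / Suc k"
    by metis
  have est: "(norm (f j - f k))\<^sup>2 \<le> (8 * \<delta> + 4) / Suc N" if "N \<le> j" "N \<le> k" for j k N
  proof -
    have near: "(norm (y - f i))\<^sup>2 \<le> \<delta>\<^sup>2 + (2 * \<delta> + 1) / Suc N" if "N \<le> i" for i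
    proof -
      have "norm (y - f i) \<le> \<delta> + 1 / Suc N"
        using f(2)[of i] that by (smt (verit) frac_le of_nat_0_less_iff of_nat_mono zero_less_Suc Suc_le_mono)
      then have "(norm (y - f i))\<^sup>2 \<le> (\<delta> + 1 / Suc N)\<^sup>2"
        by (intro power_mono) auto
      also have "\<dots> = \<delta>\<^sup>2 + 2 * \<delta> * (1 / Suc N) + (1 / Suc N) * (1 / Suc N)"
        by (simp only: power2_sum power2_eq_square) algebra
      also have "(1 / Suc N) * (1 / Suc N) \<le> 1 / real (Suc N)"
        by (rule mult_left_le) auto
      finally show ?thesis by (simp add: add_divide_distrib)
    qed
    have "(1/2) *\<^sub>R (f j + f k) \<in> M"
      using f(1) sub by (intro subspace_scale subspace_add) auto
    then have "\<delta> \<le> norm (y - (1/2) *\<^sub>R (f j + f k))" by (rule \<delta>)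
    also have "\<dots> = norm ((1/2) *\<^sub>R ((y - f j) + (y - f k)))"
      by (rule arg_cong[of _ _ norm]) (simp add: algebra_simps flip: scaleR_add_left)
    finally have "2 * \<delta> \<le> norm ((y - f j) + (y - f k))" by simp
    then have "(2 * \<delta>)\<^sup>2 \<le> (norm ((y - f j) + (y - f k)))\<^sup>2"
      using \<delta>0 by (intro power_mono) auto
    moreover have "norm ((y - f j) - (y - f k)) = norm (f j - f k)"
      by (simp add: norm_minus_commute)
    ultimately have "(norm (f j - f k))\<^sup>2 \<le> 2 * (norm (y - f j))\<^sup>2 + 2 * (norm (y - f k))\<^sup>2 - 4 * \<delta>\<^sup>2"
      using parallelogram[of "y - f j" "y - f k"] by (simp add: power_mult_distrib)
    also have "\<dots> \<le> 4 * ((2 * \<delta> + 1) / Suc N)"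
      using near[OF \<open>N \<le> j\<close>] near[OF \<open>N \<le> k\<close>] by linarith
    finally show ?thesis by (simp add: algebra_simps)
  qed
  have "Cauchy f"
  proof (rule metric_CauchyI)
    fix e :: real assume e: "0 < e"
    obtain N :: nat where N: "(8 * \<delta> + 4) / e\<^sup>2 < N"
      using reals_Archimedean2 by blast
    have "dist (f j) (f k) < e" if "N \<le> j" "N \<le> k" for j k
    proof -
      have "(norm (f j - f k))\<^sup>2 \<le> (8 * \<delta> + 4) / Suc N" using est that by blast
      also have "\<dots> < e\<^sup>2"
      proof -
        have "8 * \<delta> + 4 < real N * e\<^sup>2" using N e by (simp add: field_simps)
        also have "\<dots> \<le> real (Suc N) * e\<^sup>2" by (intro mult_right_mono) auto
        finally show ?thesis by (simp add: field_simps)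
      qed
      finally show ?thesis
        using e by (simp add: dist_norm power2_less_imp_less)
    qed
    then show "\<exists>N. \<forall>j\<ge>N. \<forall>k\<ge>N. dist (f j) (f k) < e" by blast
  qed
  then obtain q where q: "f \<longlonglongrightarrow> q"
    using Cauchy_convergent convergent_def by blast
  have qM: "q \<in> M"
    using \<open>closed M\<close> f(1) q closed_sequentially by blast
  have "norm (y - q) \<le> \<delta> + 0"
  proof (rule LIMSEQ_le)
    show "(\<lambda>k. norm (y - f k)) \<longlonglongrightarrow> norm (y - q)" by (intro tendsto_intros q)
    show "(\<lambda>k. \<delta> + 1 / real (Suc k)) \<longlonglongrightarrow> \<delta> + 0"
      by (intro tendsto_intros LIMSEQ_Suc[OF lim_1_over_n])
    show "\<exists>N. \<forall>n\<ge>N. norm (y - f n) \<le> \<delta> + 1 / real (Suc n)"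
      using f(2) less_imp_le by blast
  qed
  then have min: "norm (y - q) \<le> norm (y - m)" if "m \<in> M" for m
    using \<delta>[OF that] by simp
  have "Re (cinner (y - q) m) = 0" if "m \<in> M" for m
  proof (cases "m = 0")
    case False
    define t where "t = Re (cinner (y - q) m) / (norm m)\<^sup>2"
    have "q + t *\<^sub>R m \<in> M" using qM that sub by (intro subspace_add subspace_scale)
    then have "(norm (y - q))\<^sup>2 \<le> (norm ((y - q) - t *\<^sub>R m))\<^sup>2"
      using min[of "q + t *\<^sub>R m"] by (intro power_mono) (auto simp: algebra_simps)
    also have "\<dots> = (norm (y - q))\<^sup>2 - 2 * t * Re (cinner (y - q) m) + t\<^sup>2 * (norm m)\<^sup>2"
      by (subst norm_diff_sq) (simp add: cinner_scaleR_right power_mult_distrib)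
    finally have "2 * t * Re (cinner (y - q) m) \<le> t\<^sup>2 * (norm m)\<^sup>2" by simp
    moreover have "Re (cinner (y - q) m) = t * (norm m)\<^sup>2"
      using False by (simp add: t_def)
    ultimately have "t\<^sup>2 * (norm m)\<^sup>2 \<le> 0" by (simp add: power2_eq_square)
    then have "t = 0" using False
      by (metis mult_eq_0_iff norm_eq_zero order_antisym_conv power_not_zero mult_nonneg_nonneg zero_le_power2)
    then show ?thesis using False by (simp add: t_def)
  qed simp
  then show ?thesis using qM by blast
qed


section \<open>Square roots by iteration\<close>

text \<open>The equation \<open>2 d = b + d d\<close> says \<open>(1 - d)\<^sup>2 = 1 - b\<close>, but it makes sense without a unit. The
  iteration \<open>d \<mapsto> (b + d d) / 2\<close> converges even for \<open>norm b = 1\<close>, because its increments are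
  majorized by those of the same iteration for the number \<open>1\<close>, which increases to \<open>1\<close>. The
  set \<open>C\<close> transports properties of \<open>b\<close> that survive the iteration to the solution.\<close>

lemma quadratic_fixpoint:
  fixes p :: "'b::banach \<Rightarrow> 'b \<Rightarrow> 'b"
  assumes p: "bounded_bilinear p" and np: "\<And>x y. norm (p x y) \<le> norm x * norm y"
    and C: "closed C" "0 \<in> C" "\<And>d. d \<in> C \<Longrightarrow> (1/2) *\<^sub>R (b + p d d) \<in> C"
    and b: "norm b \<le> 1"
  obtains d where "d \<in> C" and "norm d \<le> 1" and "2 *\<^sub>R d = b + p d d"
proof -
  interpret p: bounded_bilinear p by (rule p)
  define F where "F d = (1/2) *\<^sub>R (b + p d d)" for d
  define D where "D k = (F ^^ k) 0" for k
  define G where "G r = (1 + r * r) / 2" for r :: real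
  define R where "R k = (G ^^ k) 0" for k
  have D [simp]: "D 0 = 0" "D (Suc k) = F (D k)" for k by (simp_all add: D_def)
  have R [simp]: "R 0 = 0" "R (Suc k) = G (R k)" for k by (simp_all add: R_def)
  have R01: "0 \<le> R k \<and> R k \<le> 1" for k
  proof (induction k)
    case (Suc k)
    then have "R k * R k \<le> 1 * 1" by (intro mult_mono) auto
    then show ?case using Suc by (simp add: G_def)
  qed simp
  have Rinc: "R k \<le> R (Suc k)" for k
    using zero_le_power2[of "1 - R k"] by (simp add: G_def power2_eq_square algebra_simps)
  have nD: "norm (D k) \<le> R k" for k
  proof (induction k)
    case (Suc k)
    have "norm (b + p (D k) (D k)) \<le> norm b + norm (D k) * norm (D k)"
      by (intro norm_triangle_le add_mono np order_refl)
    also have "\<dots> \<le> 1 + R k * R k"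
      using Suc b R01 by (intro add_mono mult_mono) auto
    finally show ?case by (simp add: F_def G_def)
  qed simp
  have inc: "norm (D (Suc k) - D k) \<le> R (Suc k) - R k" for k
  proof (induction k)
    case 0
    then show ?case using b by (simp add: F_def G_def p.zero_left)
  next
    case (Suc k)
    have "F x - F y = (1/2) *\<^sub>R (p x (x - y) + p (x - y) y)" for x y
      by (simp add: F_def p.diff_left p.diff_right algebra_simps)
    then have "D (Suc (Suc k)) - D (Suc k)
        = (1/2) *\<^sub>R (p (D (Suc k)) (D (Suc k) - D k) + p (D (Suc k) - D k) (D k))"
      by (simp only: D(2))
    also have "norm \<dots> \<le> (1/2) * (norm (D (Suc k)) * norm (D (Suc k) - D k)
                                   + norm (D (Suc k) - D k) * norm (D k))"
    proof -
      have "norm (p (D (Suc k)) (D (Suc k) - D k) + p (D (Suc k) - D k) (D k))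
          \<le> norm (D (Suc k)) * norm (D (Suc k) - D k) + norm (D (Suc k) - D k) * norm (D k)"
        by (intro norm_triangle_le add_mono np)
      then show ?thesis unfolding norm_scaleR by (intro mult_mono) auto
    qed
    also have "\<dots> \<le> (1/2) * (R (Suc k) * (R (Suc k) - R k) + (R (Suc k) - R k) * R k)"
      using Suc nD[of k] nD[of "Suc k"] R01[of k] R01[of "Suc k"] Rinc[of k]
      by (intro mult_left_mono add_mono mult_mono) auto
    also have "\<dots> = R (Suc (Suc k)) - R (Suc k)"
    proof -
      have "(1/2) * (a * (a - b) + (a - b) * b) = G a - G b" for a b
        by (simp add: G_def field_simps)
      then show ?thesis by (simp only: R(2))
    qed
    finally show ?case .
  qed
  have le: "norm (D (k + j) - D k) \<le> R (k + j) - R k" for k j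
  proof (induction j)
    case (Suc j)
    have "norm (D (k + Suc j) - D k) \<le> norm (D (Suc (k + j)) - D (k + j)) + norm (D (k + j) - D k)"
      using norm_triangle_ineq[of "D (Suc (k + j)) - D (k + j)" "D (k + j) - D k"] by simp
    also have "\<dots> \<le> (R (Suc (k + j)) - R (k + j)) + (R (k + j) - R k)"
      by (intro add_mono inc Suc)
    finally show ?case by simp
  qed simp
  have "incseq R" using Rinc by (rule incseq_SucI)
  moreover have "Bseq R" using R01 by (intro BseqI'[of _ 1]) auto
  ultimately have "Cauchy R"
    using Bseq_monoseq_convergent[of R] by (auto simp: monoseq_iff convergent_eq_Cauchy convergent_Cauchy)
  have "Cauchy D"
  proof (rule metric_CauchyI)
    fix e :: real assume "0 < e"
    then obtain N where N: "\<And>m n. m \<ge> N \<Longrightarrow> n \<ge> N \<Longrightarrow> dist (R m) (R n) < e"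
      using \<open>Cauchy R\<close> by (metis metric_CauchyD)
    have *: "dist (D m) (D n) < e" if "N \<le> m" "m \<le> n" for m n
    proof -
      obtain j where j: "n = m + j" using \<open>m \<le> n\<close> le_Suc_ex by blast
      have "dist (D m) (D n) \<le> R n - R m"
        using le[of m j] by (simp add: j dist_norm norm_minus_commute)
      also have "\<dots> < e" using N[of m n] that by (simp add: dist_real_def)
      finally show ?thesis .
    qed
    then show "\<exists>M. \<forall>m\<ge>M. \<forall>n\<ge>M. dist (D m) (D n) < e"
      by (metis dist_commute nle_le)
  qed
  then obtain d where d: "D \<longlonglongrightarrow> d"
    using Cauchy_convergent convergent_def by blast
  have "D k \<in> C" for k
    by (induction k) (use C(2,3) in \<open>auto simp: F_def\<close>)
  then have "d \<in> C" using C(1) d closed_sequentially by blast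
  moreover have "norm d \<le> 1"
    using Lim_bounded[OF tendsto_norm[OF d], of 0 1] nD R01 order_trans by blast
  moreover have "(\<lambda>k. D (Suc k)) \<longlonglongrightarrow> F d"
    unfolding D(2) F_def by (intro tendsto_intros p.tendsto d)
  then have "F d = d" using d LIMSEQ_Suc LIMSEQ_unique by blast
  then have "2 *\<^sub>R d = b + p d d"
    by (metis F_def scaleR_scaleR mult_1 nonzero_divide_eq_eq
        scaleR_one zero_neq_numeral times_divide_eq_right)
  ultimately show thesis using that by blast
qed


section \<open>C*-algebras\<close>

lemma star_scaleR: "star (r *\<^sub>R a) = r *\<^sub>R star (a :: 'a::cstar_algebra)"
  by (metis scaleC_of_real star_scaleC complex_cnj_complex_of_real)

lemma star_zero [simp]: "star (0 :: 'a::cstar_algebra) = 0"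
  using star_scaleR[of 0 0] by simp

lemma star_minus: "star (- a) = - star (a :: 'a::cstar_algebra)"
  using star_scaleR[of "-1" a] by simp

lemma star_diff: "star (a - b) = star a - star (b :: 'a::cstar_algebra)"
  using star_add[of a "- b"] by (simp add: star_minus)

lemma norm_star: "norm (star a) = norm (a :: 'a::cstar_algebra)"
proof -
  have *: "norm b \<le> norm (star b)" for b :: 'a
  proof (cases "b = 0")
    case False
    have "norm b * norm b \<le> norm (star b) * norm b"
      using cstar_identity[of b] norm_mult_ineq[of "star b" b] by (simp add: power2_eq_square)
    then show ?thesis using False by simp
  qed simp
  show ?thesis using *[of a] *[of "star a"] by (simp add: star_star)
qed

lemma bounded_linear_star: "bounded_linear (star :: 'a::cstar_algebra \<Rightarrow> 'a)"
  by (rule bounded_linear_intro[where K = 1]) (simp_all add: star_add star_scaleR norm_star)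

lemmas continuous_on_star [continuous_intros] = bounded_linear.continuous_on[OF bounded_linear_star]

lemma closed_selfadjoint_elements: "closed (selfadjoint_elements :: 'a::cstar_algebra set)"
  unfolding selfadjoint_elements_def
  by (intro closed_Collect_eq continuous_intros)

lemma subspace_selfadjoint_elements: "subspace (selfadjoint_elements :: 'a::cstar_algebra set)"
  by (rule subspaceI) (auto simp: selfadjoint_elements_def star_add star_scaleR)

lemma selfadjoint_sqrt:
  fixes b :: "'a::cstar_algebra"
  assumes "star b = b" and "norm b \<le> 1"
  obtains d where "star d = d" and "norm d \<le> 1" and "2 *\<^sub>R d = b + d * d"
    and "\<And>t. t * b = b * t \<Longrightarrow> t * d = d * t"
proof -
  note found = that
  let ?C = "{d. star d = d \<and> (\<forall>t. t * b = b * t \<longrightarrow> t * d = d * t)}"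
  show thesis
  proof (rule quadratic_fixpoint[OF bounded_bilinear_mult norm_mult_ineq, of ?C b])
    show "closed ?C"
      by (intro closed_Collect_conj closed_Collect_all closed_Collect_imp closed_Collect_eq
          open_Collect_const continuous_intros)
    show "0 \<in> ?C" by simp
    show "norm b \<le> 1" by (rule assms(2))
    show "(1/2) *\<^sub>R (b + d * d) \<in> ?C" if "d \<in> ?C" for d
    proof -
      have "t * ((1/2) *\<^sub>R (b + d * d)) = (1/2) *\<^sub>R (b + d * d) * t" if tb: "t * b = b * t" for t
      proof -
        have "t * d = d * t" using \<open>d \<in> ?C\<close> tb by blast
        then have "t * (d * d) = d * d * t" by (metis mult.assoc)
        with tb show ?thesis by (simp add: distrib_left distrib_right)
      qed
      moreover have "star ((1/2) *\<^sub>R (b + d * d)) = (1/2) *\<^sub>R (b + d * d)"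
      proof -
        have "star d = d" using that by blast
        then show ?thesis using assms(1) by (simp add: star_scaleR star_add star_mult)
      qed
      ultimately show ?thesis by (intro CollectI conjI allI impI)
    qed
    show thesis if "d \<in> ?C" "norm d \<le> 1" "2 *\<^sub>R d = b + d * d" for d
    proof (rule found[of d])
      show "t * d = d * t" if "t * b = b * t" for t
        using \<open>d \<in> ?C\<close> that by blast
    qed (use that in blast)+
  qed
qed


section \<open>Representations are contractive\<close>

lemma bounded_clinearD:
  assumes "bounded_clinear T"
  shows "T (x + y) = T x + T y" and "T (c *\<^sub>C x) = c *\<^sub>C T x" and "T (r *\<^sub>R x) = r *\<^sub>R T x"
    and "bounded_linear T"
proof -
  have l: "Vector_Spaces.linear scaleC scaleC T"
    using assms by (simp add: bounded_clinear_def)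
  interpret T: Vector_Spaces.linear scaleC scaleC T by (rule l)
  show 1: "T (x + y) = T x + T y" for x y by (rule T.add)
  show 2: "T (c *\<^sub>C x) = c *\<^sub>C T x" for c x by (rule T.scale)
  show 3: "T (r *\<^sub>R x) = r *\<^sub>R T x" for r x using 2 by (metis scaleC_of_real)
  obtain K where "\<forall>x. norm (T x) \<le> K * norm x"
    using assms by (auto simp: bounded_clinear_def)
  then show "bounded_linear T"
    using 1 3 by (intro bounded_linear_intro[where K = K]) (auto simp: mult.commute)
qed

context cstar_representation
begin

lemmas rep_add_right = bounded_clinearD(1)[OF rep_bounded]
lemmas rep_scaleC_right = bounded_clinearD(2)[OF rep_bounded]
lemmas rep_scaleR_right = bounded_clinearD(3)[OF rep_bounded]
lemmas rep_bounded_linear = bounded_clinearD(4)[OF rep_bounded]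

lemmas rep_diff_right = linear_diff[OF bounded_linear.linear[OF rep_bounded_linear]]
lemmas rep_zero_right = linear_0[OF bounded_linear.linear[OF rep_bounded_linear]]

lemma rep_scaleR: "\<pi> (r *\<^sub>R a) x = r *\<^sub>R \<pi> a x"
  by (metis rep_scaleC scaleC_of_real)

lemma rep_zero: "\<pi> 0 x = 0"
  using rep_scaleR[of 0 0 x] by simp

lemma rep_minus: "\<pi> (- a) x = - \<pi> a x"
  using rep_scaleR[of "-1" a x] by simp

lemma rep_diff: "\<pi> (a - b) x = \<pi> a x - \<pi> b x"
  using rep_add[of a "- b" x] by (simp add: rep_minus)

lemma rep_star': "cinner (\<pi> a x) y = cinner x (\<pi> (star a) y)"
  using rep_star[of "star a"] by (simp add: star_star)

text \<open>For \<open>norm a \<le> 1\<close> write \<open>1 - a\<^sup>* a = (1 - d)\<^sup>2\<close> with \<open>d\<close> self-adjoint; then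
  \<open>norm x ^ 2 - norm (\<pi> a x) ^ 2 = norm (x - \<pi> d x) ^ 2\<close>.\<close>

lemma rep_contractive: "norm (\<pi> a x) \<le> norm a * norm x"
proof -
  have unit: "norm (\<pi> a x) \<le> norm x" if "norm a \<le> 1" for a x
  proof -
    have "norm (star a * a) \<le> 1" using that by (simp add: cstar_identity power_le_one)
    moreover have "star (star a * a) = star a * a" by (simp add: star_mult star_star)
    ultimately obtain d where d: "star d = d" "2 *\<^sub>R d = star a * a + d * d"
      using selfadjoint_sqrt by metis
    have "(norm (\<pi> a x))\<^sup>2 = Re (cinner (\<pi> (star a * a) x) x)"
      by (simp add: norm_sq_cinner rep_mult rep_star)
    also have "star a * a = 2 *\<^sub>R d - d * d" using d(2) by simp
    also have "Re (cinner (\<pi> (2 *\<^sub>R d - d * d) x) x) = 2 * Re (cinner (\<pi> d x) x) - (norm (\<pi> d x))\<^sup>2"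
      using d(1) by (simp add: rep_diff rep_scaleR rep_mult cinner_algebra norm_sq_cinner rep_star')
    also have "\<dots> = (norm x)\<^sup>2 - (norm (x - \<pi> d x))\<^sup>2"
      by (simp add: norm_diff_sq Re_cinner_commute)
    finally have "(norm (\<pi> a x))\<^sup>2 \<le> (norm x)\<^sup>2" by simp
    then show ?thesis by (simp add: power2_le_iff_abs_le)
  qed
  show ?thesis
  proof (cases "a = 0")
    case False
    then have "norm (\<pi> ((1 / norm a) *\<^sub>R a) x) \<le> norm x"
      by (intro unit) simp
    then show ?thesis using False by (simp add: rep_scaleR field_simps)
  qed (simp add: rep_zero)
qed

lemma rep_bounded_linear_left: "bounded_linear (\<lambda>a. \<pi> a x)"
  by (rule bounded_linear_intro[where K = "norm x"]) (simp_all add: rep_add rep_scaleR rep_contractive)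

end


section \<open>Schur's lemma\<close>

text \<open>Scale \<open>S\<close> to a contraction and let \<open>\<bar>S\<bar> = 1 - D\<close> be the square root of \<open>S\<^sup>2\<close>. The operators
  \<open>\<bar>S\<bar> - S\<close> and \<open>\<bar>S\<bar> + S\<close> have product zero, and the kernel of the first is a closed invariant subspace. If
  it is everything, then \<open>S = \<bar>S\<bar>\<close>; if it is zero, then the second operator, which maps into it,
  vanishes and \<open>S = - \<bar>S\<bar>\<close>.\<close>

lemma (in irreducible_representation) commutant_definite:
  assumes S: "selfadjoint_op S" and com: "\<And>a v. S (\<pi> a v) = \<pi> a (S v)"
  shows "(\<forall>v. 0 \<le> Re (cinner (S v) v)) \<or> (\<forall>v. Re (cinner (S v) v) \<le> 0)"
proof -
  \<comment> \<open>Scaling does not affect the sign of the form, so \<open>S\<close> may be taken to be a contraction.\<close>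
  have contr: "(\<forall>v. 0 \<le> Re (cinner (S v) v)) \<or> (\<forall>v. Re (cinner (S v) v) \<le> 0)"
    if S: "selfadjoint_op S" and com: "\<And>a v. S (\<pi> a v) = \<pi> a (S v)"
      and nS: "\<And>v. norm (S v) \<le> norm v" for S :: "'b \<Rightarrow> 'b"
  proof -
    have bS: "bounded_clinear S" and saS: "\<And>x y. cinner (S x) y = cinner x (S y)"
      using S by (auto simp: selfadjoint_op_def)
    note lS = bounded_clinearD[OF bS]
    have SD: "S (x - y) = S x - S y" for x y
      using linear_diff[OF bounded_linear.linear[OF lS(4)]] .
    define B where "B = Blinfun (\<lambda>v. v - S (S v))"
    have B: "blinfun_apply B v = v - S (S v)" for v
      unfolding B_def
      by (subst bounded_linear_Blinfun_apply)
         (intro bounded_linear_sub bounded_linear_ident bounded_linear_compose[OF lS(4)] lS(4), simp)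
    have nB: "norm B \<le> 1"
    proof (rule norm_blinfun_bound)
      fix v
      have "(norm (v - S (S v)))\<^sup>2 = (norm v)\<^sup>2 - 2 * (norm (S v))\<^sup>2 + (norm (S (S v)))\<^sup>2"
        using saS[of v "S v"] by (simp add: norm_diff_sq) (simp add: norm_sq_cinner)
      also have "\<dots> \<le> (norm v)\<^sup>2"
        using power_mono[OF nS[of "S v"] norm_ge_zero, of 2] by (smt (verit) zero_le_power2)
      finally show "norm (blinfun_apply B v) \<le> 1 * norm v"
        by (simp add: B power2_le_iff_abs_le)
    qed simp
    let ?C = "{D :: 'b \<Rightarrow>\<^sub>L 'b. (\<forall>a v. D (\<pi> a v) = \<pi> a (D v)) \<and> (\<forall>c v. D (c *\<^sub>C v) = c *\<^sub>C D v)
                \<and> (\<forall>v. D (S v) = S (D v)) \<and> (\<forall>x y. cinner (D x) y = cinner x (D y))}"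
    have closedC: "closed ?C"
      by (intro closed_Collect_conj closed_Collect_all closed_Collect_eq continuous_intros
          bounded_linear.continuous_on[OF lS(4)] bounded_linear.continuous_on[OF rep_bounded_linear])
    have zeroC: "0 \<in> ?C"
      using lS(3)[of 0 0] by (simp add: rep_zero_right)
    have stepC: "(1/2) *\<^sub>R (B + (D o\<^sub>L D)) \<in> ?C" if "D \<in> ?C" for D
      using that
      by (auto simp: B blinfun.bilinear_simps com saS lS SD rep_add_right rep_diff_right rep_scaleR_right
          cinner_algebra scaleC_add_right scaleC_scaleR_commute complex_vector.scale_right_diff_distrib)
    obtain D where D: "D \<in> ?C" "norm D \<le> 1" and DD: "2 *\<^sub>R D = B + (D o\<^sub>L D)"
    proof (rule quadratic_fixpoint[OF bounded_bilinear_blinfun_compose norm_blinfun_compose])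
      show "closed ?C" by (rule closedC)
      show "0 \<in> ?C" by (rule zeroC)
      show "norm B \<le> 1" by (rule nB)
      show "(1/2) *\<^sub>R (B + (D o\<^sub>L D)) \<in> ?C" if "D \<in> ?C" for D using that by (rule stepC)
    qed
    have sq: "2 *\<^sub>R D v = (v - S (S v)) + D (D v)" for v
      using arg_cong[OF DD, of "\<lambda>E. blinfun_apply E v"] by (simp add: B blinfun.bilinear_simps)
    have pos: "0 \<le> Re (cinner (v - D v) v)" for v
    proof -
      have "Re (cinner (D v) v) \<le> norm (D v) * norm v"
        using Cauchy_Schwarz[of "D v" v] complex_Re_le_cmod[of "cinner (D v) v"] by linarith
      also have "norm (D v) \<le> 1 * norm v"
        using norm_blinfun[of D v] D(2) by (meson mult_right_mono norm_ge_zero order_trans)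
      finally show ?thesis
        by (simp add: cinner_diff_left mult_right_mono flip: norm_sq_cinner)
           (simp add: norm_sq_cinner cinner_diff_left power2_eq_square)
    qed
    define M where "M = {v. v - D v = S v}"
    have "M = {0} \<or> M = UNIV"
    proof (rule irreducible)
      show "complex_vector.subspace M"
      proof (rule complex_vector.subspaceI)
        show "0 \<in> M" using lS(3)[of 0 0] by (simp add: M_def blinfun.bilinear_simps)
        show "x + y \<in> M" if "x \<in> M" "y \<in> M" for x y
          using that by (simp add: M_def lS blinfun.bilinear_simps algebra_simps)
        show "c *\<^sub>C x \<in> M" if "x \<in> M" for c x
        proof -
          have "D (c *\<^sub>C x) = c *\<^sub>C D x" using D(1) by blast
          then show ?thesis
            using that by (simp add: M_def lS flip: complex_vector.scale_right_diff_distrib)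
        qed
      qed
      show "closed M"
        unfolding M_def
        by (intro closed_Collect_eq continuous_intros bounded_linear.continuous_on[OF lS(4)])
      show "\<pi> a ` M \<subseteq> M" for a
        using D(1) by (auto simp: M_def com simp flip: rep_diff_right)
    qed
    then show ?thesis
    proof
      assume M: "M = {0}"
      have "v - D v + S v \<in> M" for v
        using sq[of v] D(1)
        by (simp add: M_def lS SD blinfun.bilinear_simps scaleR_2 algebra_simps)
      then have "S v = - (v - D v)" for v
        using M by (metis singletonD add.commute eq_neg_iff_add_eq_0)
      then show ?thesis using pos by (simp add: cinner_diff_left)
    next
      assume "M = UNIV"
      then have "v \<in> M" for v by simp
      then have "S v = v - D v" for v by (simp add: M_def)
      then show ?thesis using pos by simp
    qed
  qed
  have bS: "bounded_clinear S" and saS: "\<And>x y. cinner (S x) y = cinner x (S y)"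
    using S by (auto simp: selfadjoint_op_def)
  obtain K where K: "0 < K" "\<And>v. norm (S v) \<le> norm v * K"
    using bounded_linear.pos_bounded[OF bounded_clinearD(4)[OF bS]] by auto
  define S' where "S' v = (1 / K) *\<^sub>R S v" for v
  have nS': "norm (S' v) \<le> norm v" for v
    using K by (simp add: S'_def field_simps)
  have "selfadjoint_op S'"
    unfolding selfadjoint_op_def bounded_clinear_def
  proof (intro conjI allI)
    show "Vector_Spaces.linear scaleC scaleC S'"
      by unfold_locales
         (simp_all add: S'_def bounded_clinearD[OF bS] scaleC_scaleR_commute scaleR_add_right)
    show "\<exists>K. \<forall>x. norm (S' x) \<le> K * norm x" using nS' by (intro exI[of _ 1]) simp
    show "cinner (S' x) y = cinner x (S' y)" for x y
      by (simp add: S'_def cinner_algebra saS)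
  qed
  moreover have "S' (\<pi> a v) = \<pi> a (S' v)" for a v
    by (simp add: S'_def com rep_scaleR_right)
  ultimately have "(\<forall>v. 0 \<le> Re (cinner (S' v) v)) \<or> (\<forall>v. Re (cinner (S' v) v) \<le> 0)"
    using contr nS' by blast
  then show ?thesis
    using K(1) by (auto simp: S'_def cinner_algebra zero_le_divide_iff divide_le_0_iff)
qed

text \<open>If the form of \<open>T\<close> took two different values on unit vectors, then \<open>T - c\<close> would be
  indefinite for every \<open>c\<close> between them.\<close>

lemma (in irreducible_representation) commutant_scalar:
  assumes T: "selfadjoint_op T" and com: "\<And>a v. T (\<pi> a v) = \<pi> a (T v)"
  obtains c :: real where "\<And>v. T v = c *\<^sub>R v"
proof -
  have bT: "bounded_clinear T" and saT: "\<And>x y. cinner (T x) y = cinner x (T y)"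
    using T by (auto simp: selfadjoint_op_def)
  note lT = bounded_clinearD[OF bT]
  define q where "q v = Re (cinner (T v) v)" for v
  have def: "(\<forall>v. c * (norm v)\<^sup>2 \<le> q v) \<or> (\<forall>v. q v \<le> c * (norm v)\<^sup>2)" for c :: real
  proof -
    define S where "S v = T v - c *\<^sub>R v" for v
    obtain K where K: "\<And>v. norm (T v) \<le> norm v * K"
      using bounded_linear.bounded[OF lT(4)] by auto
    have "selfadjoint_op S"
      unfolding selfadjoint_op_def bounded_clinear_def
    proof (intro conjI allI)
      show "Vector_Spaces.linear scaleC scaleC S"
        by unfold_locales
           (simp_all add: S_def lT scaleC_scaleR_commute algebra_simps
             complex_vector.scale_right_diff_distrib)
      have "norm (S v) \<le> (K + \<bar>c\<bar>) * norm v" for v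
        using norm_triangle_ineq4[of "T v" "c *\<^sub>R v"] K[of v] by (simp add: S_def algebra_simps)
      then show "\<exists>K. \<forall>x. norm (S x) \<le> K * norm x" by blast
      show "cinner (S x) y = cinner x (S y)" for x y
        by (simp add: S_def cinner_algebra saT)
    qed
    moreover have "S (\<pi> a v) = \<pi> a (S v)" for a v
      by (simp add: S_def com rep_diff_right rep_scaleR_right)
    ultimately have "(\<forall>v. 0 \<le> Re (cinner (S v) v)) \<or> (\<forall>v. Re (cinner (S v) v) \<le> 0)"
      by (rule commutant_definite)
    moreover have "Re (cinner (S v) v) = q v - c * (norm v)\<^sup>2" for v
      by (simp add: S_def q_def cinner_algebra norm_sq_cinner)
    ultimately show ?thesis by simp
  qed
  have "\<exists>c. \<forall>v. q v = c * (norm v)\<^sup>2"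
  proof (rule ccontr)
    assume no: "\<nexists>c. \<forall>v. q v = c * (norm v)\<^sup>2"
    have "\<exists>v :: 'b. v \<noteq> 0"
    proof (rule ccontr)
      assume "\<nexists>v :: 'b. v \<noteq> 0"
      then have "v = 0" for v :: 'b by blast
      then have "q v = 0 * (norm v)\<^sup>2" for v by (metis q_def cinner_zero_right mult_zero_left zero_complex.sel(1))
      with no show False by blast
    qed
    then obtain v :: 'b where v: "v \<noteq> 0" by blast
    define c where "c = q v / (norm v)\<^sup>2"
    have cv: "q v = c * (norm v)\<^sup>2" using v by (simp add: c_def)
    obtain w where w: "q w \<noteq> c * (norm w)\<^sup>2" using no by blast
    then have w0: "w \<noteq> 0" by (auto simp: q_def)
    define e where "e = q w / (norm w)\<^sup>2"
    have ew: "q w = e * (norm w)\<^sup>2" using w0 by (simp add: e_def)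
    have ce: "c \<noteq> e" using w ew by auto
    have nv: "0 < (norm v)\<^sup>2" "0 < (norm w)\<^sup>2" using v w0 by auto
    from def[of "(c + e) / 2"] show False
    proof
      assume "\<forall>u. (c + e) / 2 * (norm u)\<^sup>2 \<le> q u"
      then have "(c + e) / 2 \<le> c" "(c + e) / 2 \<le> e"
        using cv ew nv by (metis mult_le_cancel_right_pos)+
      then show False using ce by simp
    next
      assume "\<forall>u. q u \<le> (c + e) / 2 * (norm u)\<^sup>2"
      then have "c \<le> (c + e) / 2" "e \<le> (c + e) / 2"
        using cv ew nv by (metis mult_le_cancel_right_pos)+
      then show False using ce by simp
    qed
  qed
  then obtain c where c: "\<And>v. q v = c * (norm v)\<^sup>2" by blast
  have "T v - c *\<^sub>R v = 0" for v
  proof (rule quadratic_form_zero_imp_zero[where T = "\<lambda>v. T v - c *\<^sub>R v"])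
    show "T (x + y) - c *\<^sub>R (x + y) = T x - c *\<^sub>R x + (T y - c *\<^sub>R y)" for x y
      by (simp add: lT algebra_simps)
    show "T (z *\<^sub>C x) - c *\<^sub>R z *\<^sub>C x = z *\<^sub>C (T x - c *\<^sub>R x)" for z x
      by (simp add: lT scaleC_scaleR_commute complex_vector.scale_right_diff_distrib)
    fix v
    have "Im (cinner (T v) v) = 0"
      using saT[of v v] cinner_commute[of "T v" v] by (metis cnj.simps(2) neg_equal_zero)
    then show "cinner (T v - c *\<^sub>R v) v = 0"
      using c[of v] by (simp add: cinner_algebra cinner_self q_def complex_eq_iff)
  qed
  then show thesis using that by (metis right_minus_eq)
qed


section \<open>The density theorem\<close>

lemma closure_subspace:
  fixes S :: "'a::real_normed_vector set"
  assumes "subspace S"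
  shows "subspace (closure S)"
proof (rule subspaceI)
  show "0 \<in> closure S" using subspace_0[OF assms] closure_subset by blast
  show "x + y \<in> closure S" if xy: "x \<in> closure S" "y \<in> closure S" for x y
  proof -
    obtain f g where "\<forall>n. f n \<in> S" "f \<longlonglongrightarrow> x" "\<forall>n. g n \<in> S" "g \<longlonglongrightarrow> y"
      using xy unfolding closure_sequential by blast
    then have "\<forall>n. f n + g n \<in> S" "(\<lambda>n. f n + g n) \<longlonglongrightarrow> x + y"
      using subspace_add[OF assms] by (auto intro: tendsto_add)
    then show ?thesis unfolding closure_sequential by (intro exI[of _ "\<lambda>n. f n + g n"] conjI)
  qed
  show "c *\<^sub>R x \<in> closure S" if "x \<in> closure S" for x c
  proof -
    have "(\<lambda>x. c *\<^sub>R x) ` closure S \<subseteq> closure ((\<lambda>x. c *\<^sub>R x) ` S)"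
      by (rule closure_bounded_linear_image_subset[OF bounded_linear_scaleR_right])
    also have "\<dots> \<subseteq> closure S"
      using subspace_scale[OF assms] by (intro closure_mono) auto
    finally show ?thesis using that by blast
  qed
qed

context cstar_representation
begin

definition rep_tuple :: "'a \<Rightarrow> 'h ^ 'm::finite \<Rightarrow> 'h ^ 'm"
  where "rep_tuple a x = (\<chi> i. \<pi> a (x $ i))"

lemma rep_tuple_nth [simp]: "rep_tuple a x $ i = \<pi> a (x $ i)"
  by (simp add: rep_tuple_def)

lemma rep_tuple_representation:
  "cstar_representation (rep_tuple :: 'a \<Rightarrow> 'h ^ 'm::finite \<Rightarrow> 'h ^ 'm)"
proof
  fix a b :: 'a and x y :: "'h ^ 'm" and c :: complex
  show "bounded_clinear (rep_tuple a :: 'h ^ 'm \<Rightarrow> 'h ^ 'm)"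
    unfolding bounded_clinear_def
  proof (intro conjI exI allI)
    show "Vector_Spaces.linear scaleC scaleC (rep_tuple a :: 'h ^ 'm \<Rightarrow> 'h ^ 'm)"
      by unfold_locales (simp_all add: vec_eq_iff rep_add_right rep_scaleC_right)
    show "norm (rep_tuple a x) \<le> norm a * norm x" for x :: "'h ^ 'm"
      by (simp add: norm_vec_def L2_set_right_distrib L2_set_mono rep_contractive)
  qed
  show "cinner (rep_tuple (star a) x) y = cinner x (rep_tuple a y)"
    by (simp add: cinner_vec_def rep_star)
qed (simp_all add: vec_eq_iff rep_add rep_scaleC rep_mult)

end

locale nonzero_irreducible_representation = irreducible_representation \<pi>
  for \<pi> :: "'a::cstar_algebra \<Rightarrow> 'h::chilbert_space \<Rightarrow> 'h" +
  assumes nonzero: "\<exists>a x. \<pi> a x \<noteq> 0"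
begin

text \<open>The vectors annihilated by the algebra form a closed invariant subspace.\<close>

lemma nondegenerate:
  assumes "\<And>a. \<pi> a v = 0"
  shows "v = 0"
proof -
  define N where "N = {v. \<forall>a. \<pi> a v = 0}"
  have "N = {0} \<or> N = UNIV"
  proof (rule irreducible)
    show "complex_vector.subspace N"
      by (intro complex_vector.subspaceI)
         (auto simp: N_def rep_zero_right rep_add_right rep_scaleC_right)
    show "closed N"
      unfolding N_def
      by (intro closed_Collect_all closed_Collect_eq continuous_intros
          bounded_linear.continuous_on[OF rep_bounded_linear])
    show "\<pi> a ` N \<subseteq> N" for a by (auto simp: N_def rep_zero_right)
  qed
  then show ?thesis using nonzero assms by (auto simp: N_def)
qed

text \<open>This is von Neumann's density theorem in dual form: \<open>\<Sum>\<^sub>i \<langle>\<pi> a x\<^sub>i, w\<^sub>i\<rangle>\<close> is the trace of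
  \<open>\<pi> a\<close> times the finite-rank operator \<open>K = \<Sum>\<^sub>i x\<^sub>i \<otimes> w\<^sub>i\<close>, and the conclusion says that the
  quadratic form of \<open>K\<close> vanishes, so that \<open>K = 0\<close>. The projection
  onto the closure of \<open>{(\<pi> a x\<^sub>i)\<^sub>i}\<close> commutes with the algebra, so by Schur's lemma it is a matrix of
  scalars. It fixes the tuple \<open>x\<close> and annihilates the tuple \<open>w\<close>, and a scalar matrix can be moved
  from one factor of \<open>K\<close> to the other.\<close>

lemma density:
  fixes x w :: "'h ^ 'm::finite"
  assumes orth: "\<And>a. cinner (rep_tuple a x) w = 0"
  shows "(\<Sum>i\<in>UNIV. cinner (x $ i) u * cinner u (w $ i)) = 0"
proof -
  interpret T: cstar_representation "rep_tuple :: 'a \<Rightarrow> 'h ^ 'm \<Rightarrow> 'h ^ 'm"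
    by (rule rep_tuple_representation)
  define R where "R = range (\<lambda>a. rep_tuple a x)"
  define M where "M = closure R"
  have R: "subspace R"
    unfolding R_def
    using T.rep_zero[of x] by (intro subspaceI) (auto simp flip: T.rep_add T.rep_scaleR intro: rangeI)
  have M: "subspace M" unfolding M_def by (rule closure_subspace[OF R])
  have closed_M: "closed M" by (simp add: M_def)
  have Mrep: "rep_tuple a m \<in> M" if "m \<in> M" for a m
  proof -
    have "rep_tuple a ` M \<subseteq> closure (rep_tuple a ` R)"
      unfolding M_def by (rule closure_bounded_linear_image_subset[OF T.rep_bounded_linear])
    also have "\<dots> \<subseteq> M"
      unfolding M_def by (rule closure_mono) (auto simp: R_def simp flip: T.rep_mult)
    finally show ?thesis using that by blast
  qed
  have MC: "c *\<^sub>C m \<in> M" if "m \<in> M" for c m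
  proof -
    have "(*\<^sub>C) c ` M \<subseteq> closure ((*\<^sub>C) c ` R)"
      unfolding M_def by (rule closure_bounded_linear_image_subset[OF bounded_linear_scaleC])
    also have "\<dots> \<subseteq> M"
      unfolding M_def by (rule closure_mono) (auto simp: R_def simp flip: T.rep_scaleC)
    finally show ?thesis using that by blast
  qed
  have "\<exists>q\<in>M. \<forall>m\<in>M. cinner (y - q) m = 0" for y
  proof -
    obtain q where q: "q \<in> M" "\<And>m. m \<in> M \<Longrightarrow> Re (cinner (y - q) m) = 0"
      using orthogonal_foot_exists[OF M closed_M] by meson
    have "cinner (y - q) m = 0" if "m \<in> M" for m
      using q(2)[OF that] q(2)[OF MC[OF that, of \<i>]]
      by (simp add: cinner_scaleC_right complex_eq_iff)
    then show ?thesis using q(1) by blast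
  qed
  then obtain P where P: "\<And>y. P y \<in> M" "\<And>y m. m \<in> M \<Longrightarrow> cinner (y - P y) m = 0"
    by metis
  have uniq: "P y = q" if "q \<in> M" "\<And>m. m \<in> M \<Longrightarrow> cinner (y - q) m = 0" for y q
  proof -
    have qP: "q - P y \<in> M" using that(1) P(1) M by (intro subspace_diff)
    have "cinner ((y - P y) - (y - q)) (q - P y) = cinner (y - P y) (q - P y) - cinner (y - q) (q - P y)"
      by (rule cinner_diff_left)
    also have "\<dots> = 0" unfolding P(2)[OF qP] that(2)[OF qP] by simp
    finally have "cinner ((y - P y) - (y - q)) (q - P y) = 0" .
    then show ?thesis using cinner_self_eq_zero_iff[of "q - P y"] by simp
  qed
  have Padd: "P (y + z) = P y + P z" for y z
  proof (rule uniq)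
    show "P y + P z \<in> M" by (intro subspace_add M P)
    show "cinner (y + z - (P y + P z)) m = 0" if "m \<in> M" for m
      using P(2)[OF that, of y] P(2)[OF that, of z] by (simp add: cinner_algebra)
  qed
  have PC: "P (c *\<^sub>C y) = c *\<^sub>C P y" for c y
  proof (rule uniq)
    show "c *\<^sub>C P y \<in> M" by (intro MC P)
    show "cinner (c *\<^sub>C y - c *\<^sub>C P y) m = 0" if "m \<in> M" for m
      using P(2)[OF that, of y] by (simp add: cinner_algebra)
  qed
  have Prep: "P (rep_tuple a y) = rep_tuple a (P y)" for a y
  proof (rule uniq)
    show "rep_tuple a (P y) \<in> M" by (intro Mrep P)
    show "cinner (rep_tuple a y - rep_tuple a (P y)) m = 0" if "m \<in> M" for m
      using P(2)[OF Mrep[OF that], of y "star a"] by (simp add: T.rep_star' flip: T.rep_diff_right)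
  qed
  have Psa: "cinner (P y) z = cinner y (P z)" for y z
  proof -
    have "cinner (P y) (P z) = cinner y (P z)"
      using P(2)[OF P(1), of y z] by (simp add: cinner_diff_left)
    moreover have "cinner (P z) (P y) = cinner z (P y)"
      using P(2)[OF P(1), of z y] by (simp add: cinner_diff_left)
    ultimately show ?thesis using cinner_commute by metis
  qed
  have Pnorm: "norm (P y) \<le> norm y" for y
  proof -
    have "(norm y)\<^sup>2 = (norm (y - P y))\<^sup>2 + (norm (P y))\<^sup>2"
      using norm_add_sq[of "y - P y" "P y"] P(2)[OF P(1), of y y] by simp
    then have "(norm (P y))\<^sup>2 \<le> (norm y)\<^sup>2" by simp
    then show ?thesis by (simp add: power2_le_iff_abs_le)
  qed
  have Pw: "P w = 0"
  proof (rule uniq)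
    show "0 \<in> M" using M by (rule subspace_0)
    have "R \<subseteq> {m. cinner w m = 0}"
      using orth cinner_commute[of w] by (auto simp: R_def)
    moreover have "closed {m. cinner w m = 0}"
      by (intro closed_Collect_eq continuous_intros)
    ultimately have "M \<subseteq> {m. cinner w m = 0}"
      unfolding M_def by (rule closure_minimal)
    then show "cinner (w - 0) m = 0" if "m \<in> M" for m using that by auto
  qed
  have Px: "P x = x"
  proof -
    define e where "e = x - P x"
    have "rep_tuple a e = 0" for a
    proof -
      have "rep_tuple a x \<in> M"
        unfolding M_def R_def by (rule subsetD[OF closure_subset], rule rangeI)
      then have "rep_tuple a e \<in> M"
        unfolding e_def T.rep_diff_right by (rule subspace_diff[OF M _ Mrep[OF P(1)]])
      then have "cinner e (rep_tuple (star a) (rep_tuple a e)) = 0"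
        unfolding e_def by (intro P(2)) (rule Mrep)
      then show ?thesis
        by (simp add: cinner_self_eq_zero_iff flip: T.rep_star')
    qed
    then have "\<pi> a (e $ i) = 0" for a i
      by (metis rep_tuple_nth zero_index)
    then have "e = 0"
      using nondegenerate by (simp add: vec_eq_iff)
    then show ?thesis by (simp add: e_def)
  qed
  have ax_cinner: "cinner z (axis i v) = cinner (z $ i) v" for z :: "'h ^ 'm" and i v
    by (simp add: cinner_vec_def axis_def if_distrib sum.delta cong: if_cong)
  \<comment> \<open>the entries of the operator matrix of \<open>P\<close>\<close>
  define t where "t i j v = P (axis j v) $ i" for i j v
  have t_add: "t i j (v + v') = t i j v + t i j v'" for i j v v'
  proof -
    have "axis j (v + v') = axis j v + (axis j v' :: 'h ^ 'm)" by (simp add: vec_eq_iff axis_def)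
    then show ?thesis by (simp add: t_def Padd)
  qed
  have t_C: "t i j (c *\<^sub>C v) = c *\<^sub>C t i j v" for i j c v
  proof -
    have "axis j (c *\<^sub>C v) = c *\<^sub>C (axis j v :: 'h ^ 'm)" by (simp add: vec_eq_iff axis_def)
    then show ?thesis by (simp add: t_def PC)
  qed
  have t_rep: "t i j (\<pi> a v) = \<pi> a (t i j v)" for i j a v
  proof -
    have "axis j (\<pi> a v) = (rep_tuple a (axis j v) :: 'h ^ 'm)"
      by (simp add: vec_eq_iff axis_def rep_zero_right)
    then show ?thesis by (simp add: t_def Prep)
  qed
  have t_sa: "cinner (t i j v) v' = cinner v (t j i v')" for i j v v'
  proof -
    have "cinner (P (axis j v)) (axis i v') = cinner (axis j v) (P (axis i v'))" by (rule Psa)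
    also have "\<dots> = cnj (cinner (P (axis i v')) (axis j v))" by (rule cinner_commute)
    finally have "cinner (t i j v) v' = cnj (cinner (t j i v') v)" by (simp only: ax_cinner t_def)
    then show ?thesis using cinner_commute[of v "t j i v'"] by simp
  qed
  have t_norm: "norm (t i j v) \<le> norm v" for i j v
  proof -
    have "norm (t i j v) \<le> norm (P (axis j v))"
      unfolding t_def by (rule Finite_Cartesian_Product.norm_nth_le)
    also have "\<dots> \<le> norm (axis j v :: 'h ^ 'm)" by (rule Pnorm)
    finally show ?thesis by (simp add: norm_eq_sqrt_cinner ax_cinner)
  qed
  have "\<exists>c. \<forall>v. t i j v = c *\<^sub>C v" for i j
  proof -
    \<comment> \<open>For \<open>z = 1\<close> and \<open>z = \<i>\<close> these are multiples of the real and the imaginary part of \<open>t i j\<close>.\<close>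
    have scalar: "\<exists>\<alpha>::real. \<forall>v. z *\<^sub>C t i j v + cnj z *\<^sub>C t j i v = \<alpha> *\<^sub>R v" for z
    proof -
      define S where "S v = z *\<^sub>C t i j v + cnj z *\<^sub>C t j i v" for v
      have "selfadjoint_op S"
        unfolding selfadjoint_op_def bounded_clinear_def
      proof (intro conjI allI)
        show "Vector_Spaces.linear scaleC scaleC S"
          by unfold_locales
             (simp_all add: S_def t_add t_C scaleC_add_right scaleC_scaleC mult.commute)
        have "norm (S v) \<le> (2 * cmod z) * norm v" for v
        proof -
          have "norm (S v) \<le> cmod z * norm (t i j v) + cmod z * norm (t j i v)"
            unfolding S_def by (rule norm_triangle_le) (simp add: norm_scaleC_inner)
          also have "\<dots> \<le> cmod z * norm v + cmod z * norm v"
            by (intro add_mono mult_left_mono t_norm) auto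
          finally show ?thesis by (simp add: ac_simps)
        qed
        then show "\<exists>K. \<forall>x. norm (S x) \<le> K * norm x" by blast
        show "cinner (S v) v' = cinner v (S v')" for v v'
          by (simp add: S_def cinner_algebra t_sa)
      qed
      moreover have "S (\<pi> a v) = \<pi> a (S v)" for a v
        by (simp add: S_def t_rep rep_add_right rep_scaleC_right)
      ultimately obtain \<alpha> :: real where "\<And>v. S v = \<alpha> *\<^sub>R v"
        by (rule commutant_scalar) blast
      then show ?thesis unfolding S_def by blast
    qed
    obtain \<alpha> \<beta> :: real where
      \<alpha>: "\<And>v. 1 *\<^sub>C t i j v + cnj 1 *\<^sub>C t j i v = \<alpha> *\<^sub>R v" and
      \<beta>: "\<And>v. \<i> *\<^sub>C t i j v + cnj \<i> *\<^sub>C t j i v = \<beta> *\<^sub>R v"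
      using scalar[of 1] scalar[of \<i>] by metis
    have "t i j v = ((\<alpha> - \<i> * \<beta>) / 2) *\<^sub>C v" for v
    proof -
      have "2 *\<^sub>C t i j v = (t i j v + t j i v) + (- \<i>) *\<^sub>C (\<i> *\<^sub>C t i j v + cnj \<i> *\<^sub>C t j i v)"
        using complex_vector.scale_left_distrib[of 1 1 "t i j v"]
        by (simp add: scaleC_add_right scaleC_scaleC complex_vector.scale_right_diff_distrib)
      also have "\<dots> = (\<alpha> - \<i> * \<beta>) *\<^sub>C v"
        using \<alpha>[of v] \<beta>[of v]
        by (simp add: scaleC_scaleC complex_vector.scale_left_diff_distrib flip: scaleC_of_real)
      finally have "(1/2) *\<^sub>C 2 *\<^sub>C t i j v = (1/2) *\<^sub>C (\<alpha> - \<i> * \<beta>) *\<^sub>C v" by simp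
      then show ?thesis by (simp add: scaleC_scaleC)
    qed
    then show ?thesis by blast
  qed
  then obtain c where c: "\<And>i j v. t i j v = c i j *\<^sub>C v" by metis
  have c_sa: "cnj (c i j) = c j i" for i j
  proof -
    obtain v :: 'h where v: "v \<noteq> 0" using nonzero by blast
    have "c i j * cinner v v = cnj (c j i) * cinner v v"
      using t_sa[of i j v v] by (simp add: c cinner_algebra)
    then show ?thesis using v by (simp add: cinner_self_eq_zero_iff)
  qed
  have Pnth: "P y $ i = (\<Sum>j\<in>UNIV. c i j *\<^sub>C (y $ j))" for y i
  proof -
    have P0: "P 0 = 0" using PC[of 0 0] by simp
    have "P (\<Sum>j\<in>A. axis j (y $ j)) = (\<Sum>j\<in>A. P (axis j (y $ j)))" if "finite A" for A
      using that by induction (auto simp: P0 Padd)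
    moreover have "y = (\<Sum>j\<in>UNIV. axis j (y $ j))"
      by (simp add: vec_eq_iff axis_def if_distrib sum.delta cong: if_cong)
    ultimately have "P y = (\<Sum>j\<in>UNIV. P (axis j (y $ j)))" by (metis finite)
    then show ?thesis by (simp flip: t_def c)
  qed
  have "(\<Sum>i\<in>UNIV. cinner (x $ i) u * cinner u (w $ i))
      = (\<Sum>i\<in>UNIV. cinner (\<Sum>j\<in>UNIV. c i j *\<^sub>C (x $ j)) u * cinner u (w $ i))"
    by (simp only: Pnth[of x, unfolded Px, symmetric])
  also have "\<dots> = (\<Sum>i\<in>UNIV. \<Sum>j\<in>UNIV. cinner (x $ j) u * (c i j * cinner u (w $ i)))"
    by (simp add: cinner_sum_left cinner_algebra sum_distrib_left ac_simps)
  also have "\<dots> = (\<Sum>j\<in>UNIV. \<Sum>i\<in>UNIV. cinner (x $ j) u * (c i j * cinner u (w $ i)))"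
    by (rule sum.swap)
  also have "\<dots> = (\<Sum>j\<in>UNIV. cinner (x $ j) u * cinner u (\<Sum>i\<in>UNIV. c j i *\<^sub>C (w $ i)))"
    by (simp add: cinner_sum_right cinner_algebra sum_distrib_left c_sa)
  also have "\<dots> = 0"
    using Pnth[of w] by (simp add: Pw)
  finally show ?thesis .
qed

text \<open>The target is the image of the tuple \<open>x\<close> under the projection onto \<open>u\<close>, scaled by \<open>norm u ^ 2\<close>.
  The weak and the strong closure of a subspace agree, so it suffices to test against a vector
  \<open>e\<close> orthogonal to all \<open>(\<pi> s x\<^sub>i)\<^sub>i\<close> with \<open>s\<close> self-adjoint. For \<open>s = a + a\<^sup>*\<close> this orthogonality is a
  linear condition on \<open>a\<close> that involves \<open>x\<close> and \<open>e\<close> symmetrically, namely the hypothesis of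
  \<open>density\<close> for the joined tuples \<open>(x, e)\<close> and \<open>(e, x)\<close>.\<close>

lemma selfadjoint_density:
  fixes x :: "'h ^ 'm::finite"
  shows "(\<chi> i. cinner (x $ i) u *\<^sub>C u) \<in> closure ((\<lambda>s. rep_tuple s x) ` selfadjoint_elements)"
proof -
  interpret T: cstar_representation "rep_tuple :: 'a \<Rightarrow> 'h ^ 'm \<Rightarrow> 'h ^ 'm"
    by (rule rep_tuple_representation)
  define R where "R = (\<lambda>s. rep_tuple s x) ` selfadjoint_elements"
  define y :: "'h ^ 'm" where "y = (\<chi> i. cinner (x $ i) u *\<^sub>C u)"
  have "subspace R"
    unfolding R_def
    by (intro linear_subspace_image bounded_linear.linear[OF T.rep_bounded_linear_left]
        subspace_selfadjoint_elements)
  then have M: "subspace (closure R)" by (rule closure_subspace)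
  obtain q where q: "q \<in> closure R" "\<And>m. m \<in> closure R \<Longrightarrow> Re (cinner (y - q) m) = 0"
    using orthogonal_foot_exists[OF M closed_closure] by meson
  define e where "e = y - q"
  have e_sa: "Re (cinner (rep_tuple s x) e) = 0" if "star s = s" for s
  proof -
    have "rep_tuple s x \<in> closure R"
      unfolding R_def
      by (rule subsetD[OF closure_subset], rule imageI) (simp add: selfadjoint_elements_def that)
    from q(2)[OF this] show ?thesis
      unfolding e_def by (simp only: Re_cinner_commute[of _ "y - q"])
  qed
  have g: "cinner (rep_tuple a x) e + cinner (rep_tuple a e) x = 0" for a
  proof -
    have re: "Re (cinner (rep_tuple a x) e + cinner (rep_tuple a e) x) = 0" for a
    proof -
      have "Re (cinner (rep_tuple (a + star a) x) e) = 0"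
        by (rule e_sa) (simp add: star_add star_star add.commute)
      then show ?thesis
        using Re_cinner_commute[of x "rep_tuple a e"]
        by (simp add: T.rep_add cinner_add_left T.rep_star)
    qed
    show ?thesis
      using re[of a] re[of "\<i> *\<^sub>C a"]
      by (simp add: T.rep_scaleC cinner_scaleC_left complex_eq_iff)
  qed
  define X W :: "'h ^ ('m + 'm)"
    where "X = (\<chi> k. case k of Inl i \<Rightarrow> x $ i | Inr i \<Rightarrow> e $ i)"
      and "W = (\<chi> k. case k of Inl i \<Rightarrow> e $ i | Inr i \<Rightarrow> x $ i)"
  have sum_Plus: "(\<Sum>k\<in>UNIV. f k) = (\<Sum>i\<in>UNIV. f (Inl i)) + (\<Sum>i\<in>UNIV. f (Inr i))"
    for f :: "'m + 'm \<Rightarrow> complex"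
    using sum.Plus[of "UNIV :: 'm set" "UNIV :: 'm set" f] by (simp add: comp_def)
  have "cinner (rep_tuple a X) W = 0" for a
    using g[of a] unfolding cinner_vec_def sum_Plus by (simp add: X_def W_def)
  then have "(\<Sum>k\<in>UNIV. cinner (X $ k) u * cinner u (W $ k)) = 0"
    by (rule density)
  then have "(\<Sum>i\<in>UNIV. cinner (x $ i) u * cinner u (e $ i))
           + (\<Sum>i\<in>UNIV. cinner (e $ i) u * cinner u (x $ i)) = 0"
    unfolding sum_Plus by (simp add: X_def W_def)
  moreover have "(\<Sum>i\<in>UNIV. cinner (x $ i) u * cinner u (e $ i)) = cinner y e"
    by (simp add: cinner_vec_def y_def cinner_scaleC_left)
  moreover have "(\<Sum>i\<in>UNIV. cinner (e $ i) u * cinner u (x $ i)) = cinner e y"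
    unfolding cinner_vec_def y_def
    by (intro sum.cong) (auto simp: cinner_scaleC_right mult.commute simp flip: cinner_commute[of u])
  ultimately have "cinner y e + cinner e y = 0" by simp
  then have "Re (cinner y e) + Re (cinner e y) = 0" by (metis plus_complex.simps(1) zero_complex.simps(1))
  then have "Re (cinner e y) = 0" using Re_cinner_commute[of e y] by simp
  moreover have "Re (cinner e q) = 0"
    using q unfolding e_def by blast
  ultimately have "(norm e)\<^sup>2 = 0"
    unfolding norm_sq_cinner by (simp add: e_def cinner_diff_right)
  then have "y = q" by (simp add: e_def)
  then show ?thesis using q(1) by (simp add: R_def y_def)
qed

end


section \<open>A bounded functional calculus\<close>

text \<open>The relation says that \<open>(1 + q)\<^sup>* (1 + q) = 1\<close> in the unitization.\<close>

definition quasi_unitary :: "'a::cstar_algebra \<Rightarrow> bool"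
  where "quasi_unitary q \<longleftrightarrow> q + star q + star q * q = 0"

text \<open>The element \<open>(1 + v) ^ k - 1\<close>.\<close>

primrec quasi_power :: "'a::cstar_algebra \<Rightarrow> nat \<Rightarrow> 'a" where
  "quasi_power v 0 = 0"
| "quasi_power v (Suc k) = quasi_power v k + v + quasi_power v k * v"

lemma quasi_unitary_quasi_power:
  assumes "quasi_unitary v"
  shows "quasi_unitary (quasi_power v k)"
proof (induction k)
  case 0
  then show ?case by (simp add: quasi_unitary_def)
next
  case (Suc k)
  define q where "q = quasi_power v k"
  define X where "X = q + star q + star q * q"
  have eq: "(q + v + q * v) + star (q + v + q * v) + star (q + v + q * v) * (q + v + q * v)
      = X + star v * X + X * v + star v * X * v + (v + star v + star v * v)"
    by (simp add: X_def star_add star_mult algebra_simps)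
  have "X = 0" and "v + star v + star v * v = 0"
    using Suc assms by (simp_all add: quasi_unitary_def X_def q_def)
  then have "quasi_unitary (q + v + q * v)"
    unfolding quasi_unitary_def eq by simp
  then show ?case by (simp add: q_def)
qed

text \<open>By the C*-identity \<open>norm q ^ 2 = norm (q\<^sup>* q) = norm (q + q\<^sup>*)\<close>.\<close>

lemma norm_quasi_unitary:
  assumes "quasi_unitary q"
  shows "norm q \<le> 2"
proof (cases "q = 0")
  case False
  have "star q * q = - (q + star q)"
    using assms unfolding quasi_unitary_def
    by (intro iffD2[OF eq_neg_iff_add_eq_0]) (simp add: ac_simps)
  then have "norm (star q * q) = norm (q + star q)"
    by (simp only: norm_minus_cancel)
  then have "norm q * norm q \<le> 2 * norm q"
    using cstar_identity[of q] norm_triangle_ineq[of q "star q"]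
    by (simp add: norm_star power2_eq_square)
  then show ?thesis using False by simp
qed simp

context cstar_representation
begin

lemma quasi_unitary_isometry:
  assumes "quasi_unitary q"
  shows "norm (e + \<pi> q e) = norm e"
proof -
  have "\<pi> q e + \<pi> (star q) e + \<pi> (star q) (\<pi> q e) = 0"
    using arg_cong[of _ _ "\<lambda>q. \<pi> q e", OF assms[unfolded quasi_unitary_def]]
    by (simp add: rep_add rep_mult rep_zero)
  then have "Re (cinner (\<pi> q e + \<pi> (star q) e + \<pi> (star q) (\<pi> q e)) e) = 0" by simp
  then have "2 * Re (cinner e (\<pi> q e)) + (norm (\<pi> q e))\<^sup>2 = 0"
    using Re_cinner_commute[of e "\<pi> q e"] by (simp add: cinner_add_left rep_star norm_sq_cinner)
  then have "(norm (e + \<pi> q e))\<^sup>2 = (norm e)\<^sup>2" by (simp add: norm_add_sq)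
  then show ?thesis by (simp add: power2_eq_iff_nonneg)
qed

text \<open>An approximate eigenvector of an isometry is an approximate eigenvector of its powers, and
  the errors only add up.\<close>

lemma quasi_power_eigenvector:
  assumes "quasi_unitary v" and "cmod \<omega> = 1" and "norm (e + \<pi> v e - \<omega> *\<^sub>C e) \<le> \<eta>"
  shows "norm (e + \<pi> (quasi_power v k) e - \<omega> ^ k *\<^sub>C e) \<le> real k * \<eta>"
proof (induction k)
  case 0
  then show ?case by (simp add: rep_zero)
next
  case (Suc k)
  define q where "q = quasi_power v k"
  define f where "f = e + \<pi> v e - \<omega> *\<^sub>C e"
  have "e + \<pi> (quasi_power v (Suc k)) e - \<omega> ^ Suc k *\<^sub>C e
      = (f + \<pi> q f) + \<omega> *\<^sub>C (e + \<pi> q e - \<omega> ^ k *\<^sub>C e)"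
    by (simp add: f_def rep_add rep_mult rep_add_right rep_diff_right rep_scaleC_right
        scaleC_add_right complex_vector.scale_right_diff_distrib scaleC_scaleC flip: q_def)
  also have "norm \<dots> \<le> norm (f + \<pi> q f) + norm (\<omega> *\<^sub>C (e + \<pi> q e - \<omega> ^ k *\<^sub>C e))"
    by (rule norm_triangle_ineq)
  also have "\<dots> \<le> \<eta> + real k * \<eta>"
    using Suc assms quasi_unitary_isometry[OF quasi_unitary_quasi_power[OF assms(1)], of f k]
    by (intro add_mono) (simp_all add: norm_scaleC_inner f_def q_def)
  finally show ?case by (simp add: algebra_simps)
qed

text \<open>Since \<open>1 + q\<close> is an isometry with left inverse \<open>1 + q\<^sup>*\<close>, a vector almost fixed or almost negated
  by the first is so by the second. The factor 3 bounds the norm of \<open>1 + q\<^sup>*\<close>.\<close>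

lemma quasi_unitary_star_eigenvector:
  assumes "quasi_unitary q"
  shows "norm (\<pi> (star q) e) \<le> 3 * norm (\<pi> q e)"
    and "norm (\<pi> (star q) e + 2 *\<^sub>R e) \<le> 3 * norm (\<pi> q e + 2 *\<^sub>R e)"
proof -
  have eq: "\<pi> q e + \<pi> (star q) e + \<pi> (star q) (\<pi> q e) = 0"
    using arg_cong[of _ _ "\<lambda>q. \<pi> q e", OF assms[unfolded quasi_unitary_def]]
    by (simp add: rep_add rep_mult rep_zero)
  have bound: "norm (f + \<pi> (star q) f) \<le> 3 * norm f" for f
  proof -
    have "norm (\<pi> (star q) f) \<le> norm q * norm f"
      using rep_contractive[of "star q"] by (simp add: norm_star)
    also have "\<dots> \<le> 2 * norm f"
      using norm_quasi_unitary[OF assms] by (rule mult_right_mono) simp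
    finally show ?thesis using norm_triangle_ineq[of f "\<pi> (star q) f"] by simp
  qed
  have "\<pi> (star q) e = - (\<pi> q e + \<pi> (star q) (\<pi> q e))"
    using eq by (intro iffD2[OF eq_neg_iff_add_eq_0]) (simp add: ac_simps)
  then show "norm (\<pi> (star q) e) \<le> 3 * norm (\<pi> q e)"
    using bound[of "\<pi> q e"] by (simp only: norm_minus_cancel)
  define f where "f = \<pi> q e + 2 *\<^sub>R e"
  have "\<pi> (star q) e + 2 *\<^sub>R e = f + \<pi> (star q) f - (\<pi> q e + \<pi> (star q) e + \<pi> (star q) (\<pi> q e))"
    by (simp add: f_def rep_add_right rep_scaleR_right scaleR_2)
  then have "\<pi> (star q) e + 2 *\<^sub>R e = f + \<pi> (star q) f" unfolding eq by simp
  then show "norm (\<pi> (star q) e + 2 *\<^sub>R e) \<le> 3 * norm (\<pi> q e + 2 *\<^sub>R e)"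
    using bound[of f] by (simp only: f_def)
qed

text \<open>The element constructed here is \<open>f(s)\<close> for a function \<open>f\<close> close to \<open>(1 - cos (pi t)) / 2\<close>; it
  satisfies \<open>f(0) = 0\<close> and \<open>f(1) = 1\<close>, and it is Lipschitz with a constant that does not depend on
  \<open>s\<close>. In place of \<open>exp (\<i> pi s)\<close> stands the \<open>N\<close>-th power of the unitary \<open>\<surd>(1 - t\<^sup>2) + \<i> t\<close>
  for \<open>t = sin (pi / N) s\<close>, where \<open>N\<close> is large enough to make \<open>t\<close> a contraction. At \<open>s = 1\<close> that unitary is \<open>exp (\<i> pi / N)\<close>, whose \<open>N\<close>-th power is
  \<open>-1\<close>.\<close>

lemma bounded_cutoff:
  assumes "star s = s"
  obtains a where "star a = a" and "norm a \<le> 1"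
    and "\<And>e. norm (\<pi> a e) \<le> 5 * pi * norm (\<pi> s e)"
    and "\<And>e. norm (\<pi> a e - e) \<le> 5 * pi * norm (\<pi> s e - e)"
proof -
  obtain N0 :: nat where N0: "pi * norm s \<le> N0" using real_arch_simple by blast
  define N where "N = max N0 3"
  have N: "3 \<le> N" "pi * norm s \<le> N" "0 < real N" using N0 by (auto simp: N_def)
  define \<theta> where "\<theta> = pi / N"
  have \<theta>: "0 < \<theta>" "\<theta> \<le> pi / 3" "real N * \<theta> = pi"
    using N by (auto simp: \<theta>_def field_simps)
  \<comment> \<open>\<open>\<mu>\<close> and \<open>\<delta>\<close> are the values of \<open>t\<close> and \<open>d\<close> below at \<open>s = 1\<close>.\<close>
  define \<mu> where "\<mu> = sin \<theta>"
  define \<delta> where "\<delta> = 1 - cos \<theta>"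
  have \<mu>: "0 \<le> \<mu>" "\<mu> \<le> \<theta>" "\<mu> \<le> 1"
    using \<theta> sin_x_le_x[of \<theta>] sin_ge_zero[of \<theta>] pi_gt_zero by (auto simp: \<mu>_def)
  have \<delta>: "0 \<le> \<delta>" "\<delta> \<le> 1 / 2"
    using cos_monotone_0_pi_le[of \<theta> "pi / 3"] \<theta> by (auto simp: \<delta>_def cos_60)
  have \<mu>\<delta>: "2 * \<delta> = \<mu>\<^sup>2 + \<delta>\<^sup>2"
    using sin_cos_squared_add[of \<theta>] by (simp add: \<mu>_def \<delta>_def power2_eq_square algebra_simps)
  define t where "t = \<mu> *\<^sub>R s"
  have t: "star t = t" using assms by (simp add: t_def star_scaleR)
  have "norm t \<le> \<theta> * norm s"
    using \<mu> by (simp add: t_def mult_right_mono)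
  also have "\<dots> \<le> 1" using N by (simp add: \<theta>_def field_simps)
  finally have nt: "norm t \<le> 1" .
  have "norm (t * t) \<le> 1"
    using norm_mult_ineq[of t t] nt mult_le_one[of "norm t" "norm t"] by simp
  moreover have "star (t * t) = t * t" by (simp add: star_mult t)
  ultimately obtain d where d: "star d = d" "norm d \<le> 1" "2 *\<^sub>R d = t * t + d * d"
    and com: "\<And>u. u * (t * t) = t * t * u \<Longrightarrow> u * d = d * u"
    using selfadjoint_sqrt[of "t * t"] by metis
  have td: "t * d = d * t" by (rule com) (simp add: mult.assoc)
  \<comment> \<open>\<open>1 + v\<close> is the unitary \<open>\<surd>(1 - t\<^sup>2) + \<i> t\<close>.\<close>
  define v where "v = \<i> *\<^sub>C t - d"
  have sv: "star v = - (\<i> *\<^sub>C t) - d" by (simp add: v_def star_diff star_scaleC t d)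
  have "star v * v = t * t + d * d"
    unfolding sv unfolding v_def
    by (simp add: algebra_simps mult_scaleC_left mult_scaleC_right scaleC_scaleC td)
  moreover have "v + star v = - (2 *\<^sub>R d)" by (simp add: sv) (simp add: v_def scaleR_2)
  ultimately have v: "quasi_unitary v"
    unfolding quasi_unitary_def using d(3) by simp
  define \<omega> where "\<omega> = cis \<theta>"
  have \<omega>: "cmod \<omega> = 1" "\<omega> = complex_of_real (1 - \<delta>) + \<i> * complex_of_real \<mu>"
    by (simp_all add: \<omega>_def \<delta>_def \<mu>_def complex_eq_iff)
  have \<omega>N: "\<omega> ^ N = -1"
    unfolding \<omega>_def using Complex.DeMoivre[of \<theta> N] unfolding \<theta>(3) by simp
  define q where "q = quasi_power v N"
  have q: "quasi_unitary q" unfolding q_def by (rule quasi_unitary_quasi_power[OF v])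
  have contr: "norm (\<pi> u e) \<le> norm e" if "norm u \<le> 1" for u e
    using rep_contractive[of u e] mult_right_mono[OF that, of "norm e"] by simp
  have q0: "norm (\<pi> q e) \<le> 5 * pi * norm (\<pi> s e)" for e
  proof -
    have "2 *\<^sub>R \<pi> d e = \<pi> t (\<pi> t e) + \<pi> d (\<pi> d e)"
      using arg_cong[OF d(3), of "\<lambda>a. \<pi> a e"] by (simp add: rep_scaleR rep_add rep_mult)
    then have "norm (2 *\<^sub>R \<pi> d e) \<le> norm (\<pi> t e) + norm (\<pi> d e)"
      using contr[OF nt, of "\<pi> t e"] contr[OF d(2), of "\<pi> d e"]
        norm_triangle_ineq[of "\<pi> t (\<pi> t e)" "\<pi> d (\<pi> d e)"] by simp
    then have "norm (\<pi> d e) \<le> norm (\<pi> t e)" by simp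
    then have "norm (\<pi> v e) \<le> 2 * norm (\<pi> t e)"
      using norm_triangle_ineq4[of "\<i> *\<^sub>C \<pi> t e" "\<pi> d e"]
      by (simp add: v_def rep_diff rep_scaleC norm_scaleC_inner)
    also have "\<dots> \<le> 2 * (\<theta> * norm (\<pi> s e))"
      using \<mu> by (simp add: t_def rep_scaleR mult_right_mono)
    finally have "norm (e + \<pi> v e - 1 *\<^sub>C e) \<le> 2 * (\<theta> * norm (\<pi> s e))" by simp
    from quasi_power_eigenvector[OF v _ this, of N]
    have "norm (\<pi> q e) \<le> 2 * ((real N * \<theta>) * norm (\<pi> s e))" by (simp add: q_def ac_simps)
    also have "\<dots> \<le> 5 * pi * norm (\<pi> s e)"
      unfolding \<theta>(3) by (simp add: mult_right_mono)
    finally show ?thesis .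
  qed
  have q1: "norm (\<pi> q e + 2 *\<^sub>R e) \<le> 5 * pi * norm (\<pi> s e - e)" for e
  proof -
    define g where "g = \<pi> t e - \<mu> *\<^sub>R e"
    define h where "h = \<pi> d e - \<delta> *\<^sub>R e"
    have ng: "norm g \<le> \<theta> * norm (\<pi> s e - e)"
    proof -
      have "g = \<mu> *\<^sub>R (\<pi> s e - e)" by (simp add: g_def t_def rep_scaleR scaleR_diff_right)
      then show ?thesis using \<mu> by (simp add: mult_right_mono)
    qed
    have "2 *\<^sub>R \<pi> d e = \<pi> t (\<pi> t e) + \<pi> d (\<pi> d e)"
      using arg_cong[OF d(3), of "\<lambda>a. \<pi> a e"] by (simp add: rep_scaleR rep_add rep_mult)
    moreover have "2 *\<^sub>R \<delta> *\<^sub>R e = (\<mu> * \<mu>) *\<^sub>R e + (\<delta> * \<delta>) *\<^sub>R e"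
      using \<mu>\<delta> by (simp add: power2_eq_square flip: scaleR_add_left)
    ultimately have "2 *\<^sub>R h = (\<pi> t g + \<mu> *\<^sub>R g) + (\<pi> d h + \<delta> *\<^sub>R h)"
      unfolding g_def h_def
      by (simp add: rep_diff_right rep_scaleR_right algebra_simps)
    then have "norm (2 *\<^sub>R h) \<le> norm (\<pi> t g + \<mu> *\<^sub>R g) + norm (\<pi> d h + \<delta> *\<^sub>R h)"
      using norm_triangle_ineq by metis
    also have "\<dots> \<le> (norm g + \<mu> * norm g) + (norm h + \<delta> * norm h)"
      using contr[OF nt, of g] contr[OF d(2), of h] \<mu> \<delta>
      by (intro add_mono norm_triangle_le) auto
    also have "\<dots> \<le> (norm g + 1 * norm g) + (norm h + (1/2) * norm h)"
      using \<mu> \<delta> by (intro add_mono mult_right_mono) auto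
    finally have nh: "norm h \<le> 4 * norm g" by simp
    have "e + \<pi> v e - \<omega> *\<^sub>C e = \<i> *\<^sub>C g - h"
    proof -
      have "\<omega> *\<^sub>C e = (1 - \<delta>) *\<^sub>R e + \<i> *\<^sub>C \<mu> *\<^sub>R e"
        by (simp only: \<omega>(2) scaleC_add_left scaleC_scaleC[symmetric] scaleC_of_real)
      then show ?thesis
        by (simp add: v_def g_def h_def rep_diff rep_scaleC scaleR_diff_left
            complex_vector.scale_right_diff_distrib)
    qed
    also have "norm \<dots> \<le> norm (\<i> *\<^sub>C g) + norm h" by (rule norm_triangle_ineq4)
    also have "\<dots> \<le> 5 * (\<theta> * norm (\<pi> s e - e))"
      using nh ng by (simp add: norm_scaleC_inner)
    finally have "norm (e + \<pi> v e - \<omega> *\<^sub>C e) \<le> 5 * (\<theta> * norm (\<pi> s e - e))" .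
    from quasi_power_eigenvector[OF v \<omega>(1) this, of N]
    have "norm (e + \<pi> q e + e) \<le> 5 * ((real N * \<theta>) * norm (\<pi> s e - e))"
      by (simp add: q_def \<omega>N ac_simps)
    then show ?thesis
      unfolding \<theta>(3) by (simp add: scaleR_2 ac_simps)
  qed
  \<comment> \<open>the element \<open>(1 - Re (1 + q)) / 2\<close>\<close>
  define a where "a = (- (1/4)) *\<^sub>R (q + star q)"
  show thesis
  proof (rule that)
    show "star a = a" by (simp add: a_def star_scaleR star_add star_star add.commute star_minus)
    show "norm a \<le> 1"
      using norm_triangle_ineq[of q "star q"] norm_quasi_unitary[OF q] by (simp add: a_def norm_star)
    show "norm (\<pi> a e) \<le> 5 * pi * norm (\<pi> s e)" for e
    proof -
      have "norm (\<pi> a e) = (1/4) * norm (\<pi> q e + \<pi> (star q) e)"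
        by (simp add: a_def rep_scaleR rep_add rep_minus)
      also have "\<dots> \<le> (1/4) * (norm (\<pi> q e) + 3 * norm (\<pi> q e))"
        using quasi_unitary_star_eigenvector(1)[OF q, of e]
        by (intro mult_left_mono norm_triangle_le) auto
      finally show ?thesis using q0[of e] by simp
    qed
    show "norm (\<pi> a e - e) \<le> 5 * pi * norm (\<pi> s e - e)" for e
    proof -
      have "\<pi> a e - e = (- (1/4)) *\<^sub>R ((\<pi> q e + 2 *\<^sub>R e) + (\<pi> (star q) e + 2 *\<^sub>R e))"
      proof -
        have *: "\<pi> a e = (- (1/4)) *\<^sub>R (\<pi> q e + \<pi> (star q) e)"
          by (simp only: a_def rep_scaleR rep_add)
        show ?thesis unfolding * by (simp add: algebra_simps flip: scaleR_add_left)
      qed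
      then have "norm (\<pi> a e - e) = (1/4) * norm ((\<pi> q e + 2 *\<^sub>R e) + (\<pi> (star q) e + 2 *\<^sub>R e))"
        by simp
      also have "\<dots> \<le> (1/4) * (norm (\<pi> q e + 2 *\<^sub>R e) + 3 * norm (\<pi> q e + 2 *\<^sub>R e))"
        using quasi_unitary_star_eigenvector(2)[OF q, of e]
        by (intro mult_left_mono norm_triangle_le) auto
      finally show ?thesis using q1[of e] by simp
    qed
  qed
qed

end


section \<open>Bounded approximation of finite-rank operators\<close>

context nonzero_irreducible_representation
begin

text \<open>The vectors \<open>u\<close> and \<open>x\<^sub>i - \<langle>x\<^sub>i, u\<rangle> u\<close> are eigenvectors of the projection onto \<open>u\<close>. Approximating it
  on them by \<open>\<pi> s\<close>, with no control of \<open>norm s\<close>, and cutting \<open>s\<close> off keeps them approximate eigenvectors.\<close>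

lemma approx_projection_unit:
  fixes x :: "'h ^ 'n::finite"
  assumes u: "norm u = 1" and "0 < \<epsilon>"
  shows "\<exists>a\<in>selfadjoint_elements. norm a \<le> 1 \<and>
    (\<forall>i. norm (\<pi> a (x $ i) - cinner (x $ i) u *\<^sub>C u) < \<epsilon>)"
proof -
  have uu: "cinner u u = 1" by (simp add: cinner_self u)
  define c where "c i = cinner (x $ i) u" for i
  define X :: "'h ^ 'n option"
    where "X = (\<chi> k. case k of None \<Rightarrow> u | Some i \<Rightarrow> x $ i - c i *\<^sub>C u)"
  have target: "(\<chi> k. cinner (X $ k) u *\<^sub>C u) = (\<chi> k. case k of None \<Rightarrow> u | Some i \<Rightarrow> 0)"
    by (simp add: vec_eq_iff X_def uu c_def cinner_algebra split: option.split)
  define B where "B = 1 + (\<Sum>i\<in>UNIV. cmod (c i))"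
  have B: "cmod (c i) + 1 \<le> B" for i
    unfolding B_def using member_le_sum[of i UNIV "\<lambda>i. cmod (c i)"] by simp
  have B0: "0 < B" by (simp add: B_def add_pos_nonneg sum_nonneg)
  define \<eta> where "\<eta> = \<epsilon> / (5 * pi * B)"
  have "0 < \<eta>" using assms B0 by (simp add: \<eta>_def)
  with selfadjoint_density[of X u] obtain s where s: "star s = s"
    and "dist (rep_tuple s X) (\<chi> k. cinner (X $ k) u *\<^sub>C u) < \<eta>"
    unfolding closure_approachable by (auto simp: selfadjoint_elements_def)
  then have close: "norm ((rep_tuple s X - (\<chi> k. case k of None \<Rightarrow> u | Some i \<Rightarrow> 0)) $ k) < \<eta>" for k
    unfolding target dist_norm
    using Finite_Cartesian_Product.norm_nth_le le_less_trans by blast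
  have su: "norm (\<pi> s u - u) < \<eta>" using close[of None] by (simp add: X_def)
  have sx: "norm (\<pi> s (x $ i - c i *\<^sub>C u)) < \<eta>" for i using close[of "Some i"] by (simp add: X_def)
  obtain a where a: "star a = a" "norm a \<le> 1"
    "\<And>e. norm (\<pi> a e) \<le> 5 * pi * norm (\<pi> s e)"
    "\<And>e. norm (\<pi> a e - e) \<le> 5 * pi * norm (\<pi> s e - e)"
    using bounded_cutoff[OF s] by blast
  have "norm (\<pi> a (x $ i) - c i *\<^sub>C u) < \<epsilon>" for i
  proof -
    have "\<pi> a (x $ i) - c i *\<^sub>C u = c i *\<^sub>C (\<pi> a u - u) + \<pi> a (x $ i - c i *\<^sub>C u)"
      by (simp add: rep_diff_right rep_scaleC_right complex_vector.scale_right_diff_distrib)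
    also have "norm \<dots> \<le> cmod (c i) * norm (\<pi> a u - u) + norm (\<pi> a (x $ i - c i *\<^sub>C u))"
      using norm_triangle_ineq by (metis norm_scaleC_inner)
    also have "\<dots> \<le> cmod (c i) * (5 * pi * norm (\<pi> s u - u)) + 5 * pi * norm (\<pi> s (x $ i - c i *\<^sub>C u))"
      by (intro add_mono mult_left_mono a) auto
    also have "\<dots> < cmod (c i) * (5 * pi * \<eta>) + 5 * pi * \<eta>"
      using su sx[of i] by (intro add_le_less_mono mult_left_mono mult_strict_left_mono) auto
    also have "\<dots> = (cmod (c i) + 1) * (5 * pi * \<eta>)" by (simp add: algebra_simps)
    also have "\<dots> \<le> B * (5 * pi * \<eta>)"
      using B \<open>0 < \<eta>\<close> by (intro mult_right_mono) auto
    also have "\<dots> = \<epsilon>" using B0 by (simp add: \<eta>_def)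
    finally show ?thesis .
  qed
  then show ?thesis
    using a(1,2) by (intro bexI[of _ a]) (auto simp: c_def selfadjoint_elements_def)
qed

text \<open>Strong approximation of \<open>T\<close> on \<open>n\<close>-tuples by elements of \<open>E\<close> with norm at most \<open>K\<close>: the tuple and
  \<open>\<epsilon>\<close> are chosen after \<open>K\<close>. The first argument only carries the type of indices.\<close>

definition approximable :: "'n::finite itself \<Rightarrow> 'a set \<Rightarrow> real \<Rightarrow> ('h \<Rightarrow> 'h) \<Rightarrow> bool" where
  "approximable _ E K T \<longleftrightarrow> (\<forall>x :: 'h ^ 'n. \<forall>\<epsilon>>0. \<exists>a\<in>E. norm a \<le> K \<and>
     (\<forall>i. norm (\<pi> a (x $ i) - T (x $ i)) < \<epsilon>))"

lemma approximable_add: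
  fixes N :: "'n::finite itself"
  assumes "subspace E" and "approximable N E K T" and "approximable N E L S"
  shows "approximable N E (K + L) (\<lambda>v. T v + S v)"
  unfolding approximable_def
proof (intro allI impI)
  fix x :: "'h ^ 'n" and \<epsilon> :: real assume "0 < \<epsilon>"
  then have "0 < \<epsilon> / 2" by simp
  note half = this
  from assms(2)[unfolded approximable_def, THEN spec, of x, THEN spec, THEN mp, OF half]
  obtain a where a: "a \<in> E" "norm a \<le> K" "\<And>i. norm (\<pi> a (x $ i) - T (x $ i)) < \<epsilon> / 2"
    by blast
  from assms(3)[unfolded approximable_def, THEN spec, of x, THEN spec, THEN mp, OF half]
  obtain b where b: "b \<in> E" "norm b \<le> L" "\<And>i. norm (\<pi> b (x $ i) - S (x $ i)) < \<epsilon> / 2"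
    by blast
  show "\<exists>a\<in>E. norm a \<le> K + L \<and> (\<forall>i. norm (\<pi> a (x $ i) - (T (x $ i) + S (x $ i))) < \<epsilon>)"
  proof (intro bexI conjI allI)
    show "a + b \<in> E" using a(1) b(1) by (rule subspace_add[OF assms(1)])
    show "norm (a + b) \<le> K + L" using a(2) b(2) by (intro norm_triangle_le add_mono)
    fix i
    have "\<pi> (a + b) (x $ i) - (T (x $ i) + S (x $ i))
        = (\<pi> a (x $ i) - T (x $ i)) + (\<pi> b (x $ i) - S (x $ i))" (is "?l = ?r")
      by (simp add: rep_add)
    moreover have "norm ?r < \<epsilon>"
      using a(3)[of i] b(3)[of i]
        norm_triangle_ineq[of "\<pi> a (x $ i) - T (x $ i)" "\<pi> b (x $ i) - S (x $ i)"] by linarith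
    ultimately show "norm ?l < \<epsilon>" by (simp only:)
  qed
qed

lemma approximable_scaleC:
  fixes N :: "'n::finite itself"
  assumes "\<And>a. a \<in> E \<Longrightarrow> c *\<^sub>C a \<in> F" and "approximable N E K T"
  shows "approximable N F (cmod c * K) (\<lambda>v. c *\<^sub>C T v)"
  unfolding approximable_def
proof (intro allI impI)
  fix x :: "'h ^ 'n" and \<epsilon> :: real assume "0 < \<epsilon>"
  then have "0 < \<epsilon> / (cmod c + 1)" by (simp add: add_nonneg_pos)
  from assms(2)[unfolded approximable_def, THEN spec, of x, THEN spec, THEN mp, OF this]
  obtain a where a: "a \<in> E" "norm a \<le> K" "\<And>i. norm (\<pi> a (x $ i) - T (x $ i)) < \<epsilon> / (cmod c + 1)"
    by blast
  show "\<exists>a\<in>F. norm a \<le> cmod c * K \<and> (\<forall>i. norm (\<pi> a (x $ i) - c *\<^sub>C T (x $ i)) < \<epsilon>)"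
  proof (intro bexI conjI allI)
    show "c *\<^sub>C a \<in> F" by (rule assms(1)[OF a(1)])
    show "norm (c *\<^sub>C a) \<le> cmod c * K" using a(2) by (simp add: norm_scaleC mult_left_mono)
    fix i
    have "norm (\<pi> (c *\<^sub>C a) (x $ i) - c *\<^sub>C T (x $ i)) = cmod c * norm (\<pi> a (x $ i) - T (x $ i))"
      by (simp add: rep_scaleC norm_scaleC_inner flip: complex_vector.scale_right_diff_distrib)
    also have "\<dots> \<le> cmod c * (\<epsilon> / (cmod c + 1))" using a(3)[of i] by (intro mult_left_mono) auto
    also have "\<dots> < \<epsilon>" using \<open>0 < \<epsilon>\<close> by (simp add: pos_divide_less_eq add_pos_nonneg algebra_simps)
    finally show "norm (\<pi> (c *\<^sub>C a) (x $ i) - c *\<^sub>C T (x $ i)) < \<epsilon>" .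
  qed
qed

lemma approximable_scaleR:
  fixes N :: "'n::finite itself"
  assumes "subspace E" and "approximable N E K T"
  shows "approximable N E (\<bar>r\<bar> * K) (\<lambda>v. r *\<^sub>R T v)"
  using approximable_scaleC[of E "complex_of_real r" E, OF _ assms(2)] subspace_scale[OF assms(1)]
  by (simp add: scaleC_of_real)

lemma approximable_sum:
  fixes N :: "'n::finite itself"
  assumes "subspace E" and "finite A" and "\<And>k. k \<in> A \<Longrightarrow> approximable N E (K k) (T k)"
  shows "approximable N E (\<Sum>k\<in>A. K k) (\<lambda>v. \<Sum>k\<in>A. T k v)"
  using assms(2,3)
proof (induction A rule: finite_induct)
  case empty
  have "0 \<in> E" using assms(1) by (rule subspace_0)
  then show ?case by (auto simp: approximable_def rep_zero intro!: bexI[of _ 0])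
next
  case (insert k A)
  then show ?case
    using approximable_add[OF assms(1), of N "K k" "T k" "sum K A" "\<lambda>v. \<Sum>k\<in>A. T k v"] by simp
qed

lemma approximable_projection:
  "approximable N selfadjoint_elements ((norm u)\<^sup>2) (\<lambda>v. cinner v u *\<^sub>C u)"
proof (cases "u = 0")
  case True
  then show ?thesis
    using subspace_0[OF subspace_selfadjoint_elements]
    by (auto simp: approximable_def rep_zero intro!: bexI[of _ 0])
next
  case False
  define w where "w = (1 / norm u) *\<^sub>R u"
  have w: "norm w = 1" using False by (simp add: w_def)
  have "approximable N selfadjoint_elements 1 (\<lambda>v. cinner v w *\<^sub>C w)"
    unfolding approximable_def by (intro allI impI approx_projection_unit w)
  from approximable_scaleR[OF subspace_selfadjoint_elements this, of "(norm u)\<^sup>2"]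
  show ?thesis
    using False
    by (simp add: w_def cinner_algebra power2_eq_square scaleC_scaleR_commute
        flip: scaleC_of_real)
qed

text \<open>The operators \<open>p \<otimes> q + q \<otimes> p\<close> are half the difference of
  \<open>(p + q) \<otimes> (p + q)\<close> and \<open>(p - q) \<otimes> (p - q)\<close>; rescaling \<open>p\<close> and \<open>q\<close> to equal norms turns the resulting bound
  \<open>norm p ^ 2 + norm q ^ 2\<close> into a bilinear one.\<close>

lemma approximable_symmetric:
  "approximable N selfadjoint_elements (2 * norm p * norm q)
     (\<lambda>v. cinner v q *\<^sub>C p + cinner v p *\<^sub>C q)"
proof (cases "p = 0 \<or> q = 0")
  case True
  then show ?thesis
    using subspace_0[OF subspace_selfadjoint_elements]
    by (auto simp: approximable_def rep_zero intro!: bexI[of _ 0])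
next
  case False
  note E = subspace_selfadjoint_elements
  have sq: "approximable N selfadjoint_elements ((norm p)\<^sup>2 + (norm q)\<^sup>2)
      (\<lambda>v. cinner v q *\<^sub>C p + cinner v p *\<^sub>C q)" for p q
  proof -
    have "approximable N selfadjoint_elements (\<bar>1/2\<bar> * (norm (p + q))\<^sup>2 + \<bar>-1/2\<bar> * (norm (p - q))\<^sup>2)
      (\<lambda>v. (1/2) *\<^sub>R cinner v (p + q) *\<^sub>C (p + q) + (-1/2) *\<^sub>R cinner v (p - q) *\<^sub>C (p - q))"
      by (intro approximable_add approximable_scaleR approximable_projection E)
    moreover have "\<bar>1/2\<bar> * (norm (p + q))\<^sup>2 + \<bar>-1/2\<bar> * (norm (p - q))\<^sup>2 = (norm p)\<^sup>2 + (norm q)\<^sup>2"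
      using parallelogram[of p q] by simp
    moreover have "(1/2) *\<^sub>R cinner v (p + q) *\<^sub>C (p + q) + (-1/2) *\<^sub>R cinner v (p - q) *\<^sub>C (p - q)
        = cinner v q *\<^sub>C p + cinner v p *\<^sub>C q" for v
    proof -
      have "cinner v (p + q) *\<^sub>C (p + q) - cinner v (p - q) *\<^sub>C (p - q)
          = 2 *\<^sub>R (cinner v q *\<^sub>C p + cinner v p *\<^sub>C q)"
        by (simp add: cinner_algebra scaleC_add_left scaleC_add_right scaleR_2
            complex_vector.scale_right_diff_distrib complex_vector.scale_left_diff_distrib)
      then have "(1/2) *\<^sub>R (cinner v (p + q) *\<^sub>C (p + q) - cinner v (p - q) *\<^sub>C (p - q))
          = (1/2) *\<^sub>R 2 *\<^sub>R (cinner v q *\<^sub>C p + cinner v p *\<^sub>C q)" by simp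
      then show ?thesis by (simp add: scaleR_diff_right)
    qed
    ultimately show ?thesis by (simp only:)
  qed
  define r where "r = sqrt (norm q / norm p)"
  have r: "0 < r" "r\<^sup>2 = norm q / norm p" using False by (auto simp: r_def)
  have "(norm (r *\<^sub>R p))\<^sup>2 + (norm ((1/r) *\<^sub>R q))\<^sup>2 = 2 * norm p * norm q"
  proof -
    have "norm q = norm p * r\<^sup>2" using r(2) False by simp
    then show ?thesis using r(1) by (simp add: power2_eq_square field_simps)
  qed
  moreover have "cinner v ((1/r) *\<^sub>R q) *\<^sub>C r *\<^sub>R p + cinner v (r *\<^sub>R p) *\<^sub>C (1/r) *\<^sub>R q
      = cinner v q *\<^sub>C p + cinner v p *\<^sub>C q" for v
    using r(1) by (simp add: cinner_algebra scaleC_scaleC flip: scaleC_of_real)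
  ultimately show ?thesis using sq[of "r *\<^sub>R p" "(1/r) *\<^sub>R q"] by simp
qed

text \<open>An arbitrary rank-one operator has real and imaginary parts of the symmetric form.\<close>

lemma approximable_rank_one:
  "approximable N UNIV (2 * norm p * norm q) (\<lambda>v. cinner v q *\<^sub>C p)"
proof -
  have "approximable N UNIV (cmod (1/2) * (2 * norm p * norm q)
          + cmod (- \<i>/2) * (2 * norm (\<i> *\<^sub>C p) * norm q))
     (\<lambda>v. (1/2) *\<^sub>C (cinner v q *\<^sub>C p + cinner v p *\<^sub>C q)
        + (- \<i>/2) *\<^sub>C (cinner v q *\<^sub>C (\<i> *\<^sub>C p) + cinner v (\<i> *\<^sub>C p) *\<^sub>C q))"
    by (intro approximable_add approximable_scaleC[OF UNIV_I approximable_symmetric] subspace_UNIV)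
  moreover have "cmod (1/2) * (2 * norm p * norm q)
          + cmod (- \<i>/2) * (2 * norm (\<i> *\<^sub>C p) * norm q) = 2 * norm p * norm q"
    by (simp add: norm_scaleC_inner norm_divide)
  moreover have "(1/2) *\<^sub>C (cinner v q *\<^sub>C p + cinner v p *\<^sub>C q)
        + (- \<i>/2) *\<^sub>C (cinner v q *\<^sub>C (\<i> *\<^sub>C p) + cinner v (\<i> *\<^sub>C p) *\<^sub>C q) = cinner v q *\<^sub>C p" for v
  proof -
    define \<alpha> \<beta> where "\<alpha> = cinner v q" and "\<beta> = cinner v p"
    have ii: "\<i> * (\<alpha> * \<i>) = - \<alpha>" by (simp add: complex_eq_iff)
    have "cinner v (\<i> *\<^sub>C p) = - \<i> * \<beta>" by (simp add: \<beta>_def cinner_scaleC_right)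
    then have "(1/2) *\<^sub>C (\<alpha> *\<^sub>C p + \<beta> *\<^sub>C q)
        + (- \<i>/2) *\<^sub>C (\<alpha> *\<^sub>C (\<i> *\<^sub>C p) + cinner v (\<i> *\<^sub>C p) *\<^sub>C q)
      = (\<alpha>/2) *\<^sub>C p + (\<beta>/2) *\<^sub>C q + (\<alpha>/2) *\<^sub>C p + (- \<beta>/2) *\<^sub>C q"
      by (simp add: scaleC_add_right scaleC_scaleC complex_vector.scale_right_diff_distrib
          ii)
    also have "\<dots> = (\<alpha>/2 + \<alpha>/2) *\<^sub>C p" unfolding scaleC_add_left by simp
    finally show ?thesis by (simp add: \<alpha>_def \<beta>_def)
  qed
  ultimately show ?thesis by (simp only:)
qed

end


section \<open>Locally uniform approximate solutions\<close>

text \<open>The Gram matrix of an independent family is invertible, and the columns of its inverse are the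
  conjugated coefficients of the dual family.\<close>

lemma dual_family_exists:
  fixes x :: "'h::complex_inner ^ 'n::finite"
  assumes "clin_indep x"
  shows "\<exists>w :: 'h ^ 'n. \<forall>i j. cinner (x $ i) (w $ j) = (if i = j then 1 else 0)"
proof -
  define G :: "complex ^ 'n ^ 'n" where "G = (\<chi> i j. cinner (x $ i) (x $ j))"
  have inj: "inj (\<lambda>i. x $ i)" and indep: "complex_vector.independent (range (\<lambda>i. x $ i))"
    using assms by (auto simp: clin_indep_def)
  have "c = 0" if "G *v c = 0" for c
  proof -
    define y where "y = (\<Sum>j\<in>UNIV. cnj (c $ j) *\<^sub>C (x $ j))"
    have xy: "cinner (x $ i) y = (G *v c) $ i" for i
      by (simp add: y_def G_def matrix_vector_mult_def cinner_sum_right cinner_scaleC_right mult.commute)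
    have "cinner y y = (\<Sum>i\<in>UNIV. cnj (c $ i) * cinner (x $ i) y)"
      by (subst (1) y_def) (simp add: cinner_sum_left cinner_scaleC_left)
    then have "y = 0"
      using that by (simp add: xy cinner_self_eq_zero_iff)
    define u where "u v = cnj (c $ inv_into UNIV (\<lambda>i. x $ i) v)" for v
    have ux: "u (x $ i) = cnj (c $ i)" for i
      by (simp add: u_def inv_into_f_f[OF inj])
    have "(\<Sum>v\<in>range (\<lambda>i. x $ i). u v *\<^sub>C v) = y"
      using inj by (simp add: sum.reindex y_def ux)
    then have "u (x $ i) = 0" for i
      using complex_vector.independentD[OF indep, of "range (\<lambda>i. x $ i)" u "x $ i"] \<open>y = 0\<close> by simp
    then show ?thesis by (simp add: ux vec_eq_iff)
  qed
  then have "inj ((*v) G)" by (simp add: vec.inj_iff_eq_0)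
  then obtain B where "B ** G = mat 1"
    using matrix_left_invertible_injective by blast
  then have GB: "G ** B = mat 1" by (simp add: matrix_left_right_inverse)
  define w where "w = (\<chi> j. \<Sum>l\<in>UNIV. cnj (B $ l $ j) *\<^sub>C (x $ l))"
  have "cinner (x $ i) (w $ j) = (G ** B) $ i $ j" for i j
    by (simp add: w_def G_def matrix_matrix_mult_def cinner_sum_right cinner_scaleC_right mult.commute)
  then have "\<forall>i j. cinner (x $ i) (w $ j) = (if i = j then 1 else 0)"
    unfolding GB by (simp add: mat_def)
  then show ?thesis by blast
qed

lemma shrink_factor:
  fixes c V :: real
  assumes "0 < c" and "0 \<le> V"
  shows "1 / (c * (V + 1)) * V \<le> 1 / c"
proof -
  have "V / (V + 1) \<le> 1" using assms by simp
  then have "(1 / c) * (V / (V + 1)) \<le> (1 / c) * 1" using assms by (intro mult_left_mono) auto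
  then show ?thesis by simp
qed

context nonzero_irreducible_representation
begin

text \<open>One eighth of \<open>norm z\<close> is lost to the error of \<open>T\<close> and one eighth to the approximation of \<open>T\<close>.\<close>

lemma approximable_imp_near_solution:
  fixes x z :: "'h ^ 'n::finite"
  assumes E: "0 \<in> E" and T: "approximable TYPE('n) E K T" and K: "K \<le> C * norm z"
    and near: "\<And>i. norm (T (x $ i) - z $ i) \<le> norm z / (8 * real CARD('n))"
  shows "\<exists>a\<in>E. norm a \<le> C * norm z \<and> norm (rep_tuple a x - z) \<le> norm z / 4"
proof (cases "z = 0")
  case True
  have "rep_tuple 0 x = 0" by (simp add: vec_eq_iff rep_zero)
  then show ?thesis using E True by (intro bexI[of _ 0]) simp_all
next
  case False
  define N where "N = real CARD('n)"
  have N: "0 < N" by (simp add: N_def)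
  have "0 < norm z / (8 * N)" using False N by simp
  from T[unfolded approximable_def, THEN spec, of x, THEN spec, THEN mp, OF this]
  obtain a where a: "a \<in> E" "norm a \<le> K" "\<And>i. norm (\<pi> a (x $ i) - T (x $ i)) < norm z / (8 * N)"
    by blast
  have "norm ((rep_tuple a x - z) $ i) \<le> norm z / (4 * N)" for i
  proof -
    have "norm ((rep_tuple a x - z) $ i) \<le> norm (\<pi> a (x $ i) - T (x $ i)) + norm (T (x $ i) - z $ i)"
      using norm_triangle_ineq[of "\<pi> a (x $ i) - T (x $ i)" "T (x $ i) - z $ i"] by simp
    also have "\<dots> \<le> norm z / (8 * N) + norm z / (8 * N)"
      using a(3)[of i] near[of i] by (intro add_mono) (auto simp: N_def)
    also have "\<dots> = norm z / (4 * N)" by (simp add: field_simps)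
    finally show ?thesis .
  qed
  then have "norm (rep_tuple a x - z) \<le> N * (norm z / (4 * N))"
    unfolding N_def by (rule norm_vec_le_card)
  also have "\<dots> = norm z / 4" using N by simp
  finally show ?thesis using a K by force
qed

text \<open>With a dual family \<open>w\<close> of \<open>x\<^sub>0\<close> the operator \<open>\<Sum>\<^sub>k z\<^sub>k \<otimes> w\<^sub>k\<close> maps \<open>x\<^sub>0\<close> to \<open>z\<close>, and it maps
  nearby tuples approximately to \<open>z\<close>.\<close>

lemma local_near_solution:
  fixes x0 :: "'h ^ 'n::finite"
  assumes "clin_indep x0"
  shows "\<exists>C. \<exists>\<delta>>0. \<forall>x z. norm (x - x0) < \<delta> \<longrightarrow>
    (\<exists>a. norm a \<le> C * norm z \<and> norm (rep_tuple a x - z) \<le> norm z / 4)"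
proof -
  obtain w :: "'h ^ 'n" where w: "\<And>i j. cinner (x0 $ i) (w $ j) = (if i = j then 1 else 0)"
    using dual_family_exists[OF assms] by blast
  define W where "W = (\<Sum>k\<in>UNIV. norm (w $ k))"
  have W: "0 \<le> W" by (simp add: W_def sum_nonneg)
  define \<delta> where "\<delta> = 1 / (8 * real CARD('n) * (W + 1))"
  have \<delta>: "0 < \<delta>" "\<delta> * W \<le> 1 / (8 * real CARD('n))"
    using W shrink_factor[OF _ W, of "8 * real CARD('n)"] by (simp_all add: \<delta>_def)
  have "\<exists>a. norm a \<le> (2 * W) * norm z \<and> norm (rep_tuple a x - z) \<le> norm z / 4"
    if x: "norm (x - x0) < \<delta>" for x z :: "'h ^ 'n"
  proof -
    define T where "T v = (\<Sum>k\<in>UNIV. cinner v (w $ k) *\<^sub>C (z $ k))" for v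
    have T: "approximable TYPE('n) UNIV (\<Sum>k\<in>UNIV. 2 * norm (z $ k) * norm (w $ k)) T"
      unfolding T_def by (intro approximable_sum approximable_rank_one subspace_UNIV) simp
    have K: "(\<Sum>k\<in>UNIV. 2 * norm (z $ k) * norm (w $ k)) \<le> (2 * W) * norm z"
    proof -
      have "(\<Sum>k\<in>UNIV. 2 * norm (z $ k) * norm (w $ k)) \<le> (\<Sum>k\<in>UNIV. 2 * norm z * norm (w $ k))"
        by (intro sum_mono mult_right_mono mult_left_mono Finite_Cartesian_Product.norm_nth_le) auto
      then show ?thesis by (simp add: W_def sum_distrib_left ac_simps)
    qed
    have near: "norm (T (x $ i) - z $ i) \<le> norm z / (8 * real CARD('n))" for i
    proof -
      have "z $ i = (\<Sum>k\<in>UNIV. cinner (x0 $ i) (w $ k) *\<^sub>C (z $ k))"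
      proof -
        have "(\<Sum>k\<in>UNIV. cinner (x0 $ i) (w $ k) *\<^sub>C (z $ k)) = (\<Sum>k\<in>UNIV. if i = k then z $ k else 0)"
          by (intro sum.cong) (auto simp: w)
        then show ?thesis by simp
      qed
      then have "T (x $ i) - z $ i = (\<Sum>k\<in>UNIV. cinner ((x - x0) $ i) (w $ k) *\<^sub>C (z $ k))"
        by (simp add: T_def cinner_diff_left complex_vector.scale_left_diff_distrib sum_subtractf)
      also have "norm \<dots> \<le> (\<Sum>k\<in>UNIV. (norm (x - x0) * norm (w $ k)) * norm z)"
      proof (intro sum_norm_le)
        fix k
        have "cmod (cinner ((x - x0) $ i) (w $ k)) \<le> norm ((x - x0) $ i) * norm (w $ k)"
          by (rule Cauchy_Schwarz)
        also have "\<dots> \<le> norm (x - x0) * norm (w $ k)"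
          by (intro mult_right_mono Finite_Cartesian_Product.norm_nth_le) auto
        finally show "norm (cinner ((x - x0) $ i) (w $ k) *\<^sub>C (z $ k)) \<le> (norm (x - x0) * norm (w $ k)) * norm z"
          unfolding norm_scaleC_inner
          by (intro mult_mono Finite_Cartesian_Product.norm_nth_le) auto
      qed
      also have "\<dots> = norm (x - x0) * W * norm z"
        by (simp add: W_def sum_distrib_left sum_distrib_right)
      also have "\<dots> \<le> \<delta> * W * norm z"
        using x W by (intro mult_right_mono) auto
      also have "\<dots> \<le> 1 / (8 * real CARD('n)) * norm z"
        using \<delta> by (intro mult_right_mono) auto
      finally show ?thesis by simp
    qed
    show ?thesis
      using approximable_imp_near_solution[OF UNIV_I T K near] by simp
  qed
  then show ?thesis using \<delta>(1) by blast
qed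

text \<open>For self-adjoint solutions the data satisfy \<open>\<langle>z\<^sub>i, x\<^sub>j\<rangle> = \<langle>x\<^sub>i, z\<^sub>j\<rangle>\<close>. If \<open>w\<close> is dual to \<open>x\<close> and
  \<open>Z = \<Sum>\<^sub>k z\<^sub>k \<otimes> w\<^sub>k\<close>, then \<open>Z x = z\<close> but \<open>Z\<close> is in general not self-adjoint; the symmetric operator
  \<open>\<Sum>\<^sub>k (r\<^sub>k \<otimes> w\<^sub>k + w\<^sub>k \<otimes> r\<^sub>k)\<close> with \<open>r\<^sub>k = z\<^sub>k - 1/2 \<Sum>\<^sub>l \<langle>z\<^sub>k, x\<^sub>l\<rangle> w\<^sub>l\<close> has the same effect on \<open>x\<close>, because the
  subtracted half compensates the part of the second term that lies in the span of \<open>w\<close>. The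
  numbers \<open>e i k\<close> measure how far \<open>w\<close> is from being dual to \<open>x\<close>.\<close>

lemma symmetric_interpolation:
  fixes x z w :: "'h ^ 'n::finite"
  assumes sym: "\<And>i j. cinner (z $ i) (x $ j) = cinner (x $ i) (z $ j)"
    and e: "\<And>i k. cinner (x $ i) (w $ k) = (if i = k then 1 else 0) + e i k"
  defines "r \<equiv> \<lambda>k. z $ k - (1/2) *\<^sub>C (\<Sum>l\<in>UNIV. cinner (z $ k) (x $ l) *\<^sub>C (w $ l))"
  shows "(\<Sum>k\<in>UNIV. cinner (x $ i) (w $ k) *\<^sub>C r k + cinner (x $ i) (r k) *\<^sub>C (w $ k)) - z $ i
    = (\<Sum>k\<in>UNIV. e i k *\<^sub>C r k)
      - (1/2) *\<^sub>C (\<Sum>k\<in>UNIV. (\<Sum>l\<in>UNIV. cinner (x $ l) (z $ k) * e i l) *\<^sub>C (w $ k))"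
proof -
  define g where "g k = (\<Sum>l\<in>UNIV. cinner (x $ l) (z $ k) * e i l)" for k
  have "cinner (x $ i) (r k) = (1/2) * cinner (x $ i) (z $ k) - (1/2) * g k" for k
  proof -
    have "cinner (x $ i) (r k)
        = cinner (x $ i) (z $ k) - (1/2) * (\<Sum>l\<in>UNIV. cinner (x $ l) (z $ k) * cinner (x $ i) (w $ l))"
      by (simp add: r_def cinner_diff_right cinner_scaleC_right cinner_sum_right
          flip: cinner_commute[of "x $ _" "z $ k"])
    also have "(\<Sum>l\<in>UNIV. cinner (x $ l) (z $ k) * cinner (x $ i) (w $ l)) = cinner (x $ i) (z $ k) + g k"
    proof -
      have "(\<Sum>l\<in>UNIV. cinner (x $ l) (z $ k) * cinner (x $ i) (w $ l))
          = (\<Sum>l\<in>UNIV. (if i = l then cinner (x $ l) (z $ k) else 0) + cinner (x $ l) (z $ k) * e i l)"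
        by (intro sum.cong) (auto simp: e distrib_left)
      then show ?thesis by (simp add: g_def sum.distrib)
    qed
    finally show ?thesis by (simp add: algebra_simps)
  qed
  then have "(\<Sum>k\<in>UNIV. cinner (x $ i) (r k) *\<^sub>C (w $ k))
      = (1/2) *\<^sub>C (\<Sum>k\<in>UNIV. cinner (x $ i) (z $ k) *\<^sub>C (w $ k)) - (1/2) *\<^sub>C (\<Sum>k\<in>UNIV. g k *\<^sub>C (w $ k))"
    by (simp add: complex_vector.scale_left_diff_distrib sum_subtractf complex_vector.scale_sum_right
        scaleC_scaleC)
  moreover have "(\<Sum>k\<in>UNIV. cinner (x $ i) (w $ k) *\<^sub>C r k) = r i + (\<Sum>k\<in>UNIV. e i k *\<^sub>C r k)"
  proof -
    have "(\<Sum>k\<in>UNIV. (if i = k then 1 else 0) *\<^sub>C r k) = r i"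
    proof -
      have "(\<Sum>k\<in>UNIV. (if i = k then 1 else 0) *\<^sub>C r k) = (\<Sum>k\<in>UNIV. if i = k then r k else 0)"
        by (intro sum.cong) auto
      then show ?thesis by simp
    qed
    then show ?thesis by (simp add: e scaleC_add_left sum.distrib)
  qed
  moreover have "r i = z $ i - (1/2) *\<^sub>C (\<Sum>k\<in>UNIV. cinner (x $ i) (z $ k) *\<^sub>C (w $ k))"
    by (simp add: r_def sym)
  ultimately show ?thesis
    by (simp add: sum.distrib g_def)
qed

text \<open>The operator of \<open>symmetric_interpolation\<close> with \<open>w\<close> dual to \<open>x\<^sub>0\<close>; then \<open>e i k\<close> is at most
  \<open>norm (x - x\<^sub>0) norm w\<^sub>k\<close>.\<close>

lemma local_near_solution_selfadjoint:
  fixes x0 :: "'h ^ 'n::finite"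
  assumes "clin_indep x0"
  shows "\<exists>C. \<exists>\<delta>>0. \<forall>x z. norm (x - x0) < \<delta> \<longrightarrow>
    (\<forall>i j. cinner (z $ i) (x $ j) = cinner (x $ i) (z $ j)) \<longrightarrow>
    (\<exists>a\<in>selfadjoint_elements. norm a \<le> C * norm z \<and> norm (rep_tuple a x - z) \<le> norm z / 4)"
proof -
  obtain w :: "'h ^ 'n" where w: "\<And>i j. cinner (x0 $ i) (w $ j) = (if i = j then 1 else 0)"
    using dual_family_exists[OF assms] by blast
  define W where "W = (\<Sum>k\<in>UNIV. norm (w $ k))"
  have W: "0 \<le> W" by (simp add: W_def sum_nonneg)
  define b where "b = norm x0 + 1"
  have b: "0 \<le> b" by (simp add: b_def)
  define R where "R = 1 + b * W"
  have R: "0 \<le> R" using b W by (simp add: R_def)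
  define \<delta> where "\<delta> = min 1 (1 / (16 * real CARD('n) * (W * R + 1)))"
  have WR: "0 \<le> W * R" using W R by simp
  have \<delta>: "0 < \<delta>" "\<delta> \<le> 1" using WR by (auto simp: \<delta>_def add_nonneg_pos)
  have \<delta>': "\<delta> * (2 * (W * R)) \<le> 1 / (8 * real CARD('n))"
  proof -
    have "\<delta> * (W * R) \<le> (1 / (16 * real CARD('n) * (W * R + 1))) * (W * R)"
      using WR by (intro mult_right_mono) (auto simp: \<delta>_def)
    also have "\<dots> \<le> 1 / (16 * real CARD('n))"
      using WR by (intro shrink_factor) auto
    finally show ?thesis by simp
  qed
  have "\<exists>a\<in>selfadjoint_elements. norm a \<le> (2 * R * W) * norm z \<and> norm (rep_tuple a x - z) \<le> norm z / 4"
    if x: "norm (x - x0) < \<delta>" and sym: "\<And>i j. cinner (z $ i) (x $ j) = cinner (x $ i) (z $ j)"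
    for x z :: "'h ^ 'n"
  proof -
    define r where "r k = z $ k - (1/2) *\<^sub>C (\<Sum>l\<in>UNIV. cinner (z $ k) (x $ l) *\<^sub>C (w $ l))" for k
    define T where "T v = (\<Sum>k\<in>UNIV. cinner v (w $ k) *\<^sub>C r k + cinner v (r k) *\<^sub>C (w $ k))" for v
    define e where "e i k = cinner ((x - x0) $ i) (w $ k)" for i k
    have ne: "cmod (e i k) \<le> \<delta> * norm (w $ k)" for i k
    proof -
      have "cmod (e i k) \<le> norm ((x - x0) $ i) * norm (w $ k)"
        unfolding e_def by (rule Cauchy_Schwarz)
      also have "\<dots> \<le> \<delta> * norm (w $ k)"
        using x Finite_Cartesian_Product.norm_nth_le[of "x - x0" i] by (intro mult_right_mono) auto
      finally show ?thesis .
    qed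
    have "norm x \<le> b"
      using x \<delta>(2) norm_triangle_ineq[of "x - x0" x0] by (simp add: b_def)
    then have nx: "norm (x $ l) \<le> b" for l
      using Finite_Cartesian_Product.norm_nth_le[of x l] by simp
    have half: "norm ((1/2) *\<^sub>C v) \<le> norm v" for v :: 'h
      by (simp add: norm_scaleC_inner)
    have nz: "norm (z $ l) \<le> norm z" for l by (rule Finite_Cartesian_Product.norm_nth_le)
    have ncz: "cmod (cinner (x $ l) (z $ k)) \<le> b * norm z" for k l
      using Cauchy_Schwarz[of "x $ l" "z $ k"] mult_mono[OF nx nz b norm_ge_zero, of l k] by simp
    have nr: "norm (r k) \<le> R * norm z" for k
    proof -
      have "norm (\<Sum>l\<in>UNIV. cinner (z $ k) (x $ l) *\<^sub>C (w $ l)) \<le> (\<Sum>l\<in>UNIV. (b * norm z) * norm (w $ l))"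
        by (intro sum_norm_le) (simp add: norm_scaleC_inner sym mult_right_mono ncz)
      also have "\<dots> = b * W * norm z" by (simp add: W_def sum_distrib_left ac_simps)
      finally have "norm ((1/2) *\<^sub>C (\<Sum>l\<in>UNIV. cinner (z $ k) (x $ l) *\<^sub>C (w $ l))) \<le> b * W * norm z"
        by (rule order_trans[OF half])
      then show ?thesis
        unfolding r_def R_def distrib_right using nz[of k] norm_triangle_ineq4 by (smt (verit))
    qed
    have T: "approximable TYPE('n) selfadjoint_elements (\<Sum>k\<in>UNIV. 2 * norm (r k) * norm (w $ k)) T"
      unfolding T_def
      by (intro approximable_sum approximable_symmetric subspace_selfadjoint_elements) simp
    have K: "(\<Sum>k\<in>UNIV. 2 * norm (r k) * norm (w $ k)) \<le> (2 * R * W) * norm z"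
    proof -
      have "(\<Sum>k\<in>UNIV. 2 * norm (r k) * norm (w $ k)) \<le> (\<Sum>k\<in>UNIV. 2 * (R * norm z) * norm (w $ k))"
        by (intro sum_mono mult_right_mono mult_left_mono nr) auto
      then show ?thesis by (simp add: W_def sum_distrib_left ac_simps)
    qed
    have near: "norm (T (x $ i) - z $ i) \<le> norm z / (8 * real CARD('n))" for i
    proof -
      have "cinner (x $ i) (w $ k) = (if i = k then 1 else 0) + e i k" for i k
        by (simp add: e_def cinner_diff_left w)
      from symmetric_interpolation[OF sym this, of i]
      have eq: "T (x $ i) - z $ i = (\<Sum>k\<in>UNIV. e i k *\<^sub>C r k)
          - (1/2) *\<^sub>C (\<Sum>k\<in>UNIV. (\<Sum>l\<in>UNIV. cinner (x $ l) (z $ k) * e i l) *\<^sub>C (w $ k))"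
        by (simp only: T_def r_def)
      have bound1: "norm (\<Sum>k\<in>UNIV. e i k *\<^sub>C r k) \<le> \<delta> * W * (R * norm z)"
      proof -
        have "norm (\<Sum>k\<in>UNIV. e i k *\<^sub>C r k) \<le> (\<Sum>k\<in>UNIV. (\<delta> * norm (w $ k)) * (R * norm z))"
          by (intro sum_norm_le) (simp add: norm_scaleC_inner mult_mono ne nr \<delta>(1) less_imp_le)
        then show ?thesis by (simp add: W_def sum_distrib_left sum_distrib_right)
      qed
      have bound2: "norm ((1/2) *\<^sub>C (\<Sum>k\<in>UNIV. (\<Sum>l\<in>UNIV. cinner (x $ l) (z $ k) * e i l) *\<^sub>C (w $ k)))
          \<le> \<delta> * W * (R * norm z)"
      proof -
        have g: "cmod (\<Sum>l\<in>UNIV. cinner (x $ l) (z $ k) * e i l) \<le> (b * norm z) * (\<delta> * W)" for k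
        proof -
          have "cmod (\<Sum>l\<in>UNIV. cinner (x $ l) (z $ k) * e i l)
              \<le> (\<Sum>l\<in>UNIV. (b * norm z) * (\<delta> * norm (w $ l)))"
            by (intro sum_norm_le) (simp add: norm_mult mult_mono ncz ne b)
          then show ?thesis by (simp add: W_def sum_distrib_left)
        qed
        have "norm (\<Sum>k\<in>UNIV. (\<Sum>l\<in>UNIV. cinner (x $ l) (z $ k) * e i l) *\<^sub>C (w $ k))
            \<le> (\<Sum>k\<in>UNIV. ((b * norm z) * (\<delta> * W)) * norm (w $ k))"
          by (intro sum_norm_le) (simp add: norm_scaleC_inner mult_right_mono g)
        also have "\<dots> = \<delta> * W * ((b * W) * norm z)"
          by (simp add: W_def sum_distrib_left ac_simps)
        also have "\<dots> \<le> \<delta> * W * (R * norm z)"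
          using \<delta> W by (intro mult_left_mono mult_right_mono) (auto simp: R_def)
        finally show ?thesis by (rule order_trans[OF half])
      qed
      have "norm (T (x $ i) - z $ i) \<le> \<delta> * W * (R * norm z) + \<delta> * W * (R * norm z)"
        unfolding eq by (rule order_trans[OF norm_triangle_ineq4]) (intro add_mono bound1 bound2)
      also have "\<dots> = (\<delta> * (2 * (W * R))) * norm z" by simp
      also have "\<dots> \<le> 1 / (8 * real CARD('n)) * norm z"
        using \<delta>' by (intro mult_right_mono) auto
      finally show ?thesis by simp
    qed
    show ?thesis
      using approximable_imp_near_solution[OF subspace_0[OF subspace_selfadjoint_elements] T K near] .
  qed
  then show ?thesis using \<delta>(1) by blast
qed

end


section \<open>Gluing continuous selections of convex-valued maps\<close>

text \<open>Inserting \<open>0\<close> gives the supremum over the empty set the value that is natural for families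
  of nonnegative functions.\<close>

definition family_sup :: "('i \<Rightarrow> 'm \<Rightarrow> real) \<Rightarrow> 'i set \<Rightarrow> 'm \<Rightarrow> real"
  where "family_sup f J p = Sup (insert 0 ((\<lambda>j. f j p) ` J))"

lemma family_sup_upper:
  assumes "\<And>j p. f j p \<le> (1::real)" and "j \<in> J"
  shows "f j p \<le> family_sup f J p"
  unfolding family_sup_def using assms by (intro cSup_upper bdd_aboveI[of _ 1]) auto

lemma family_sup_nonneg:
  assumes "\<And>j p. f j p \<le> (1::real)"
  shows "0 \<le> family_sup f J p"
  unfolding family_sup_def using assms by (intro cSup_upper bdd_aboveI[of _ 1]) auto

lemma family_sup_least:
  assumes "0 \<le> c" and "\<And>j. j \<in> J \<Longrightarrow> f j p \<le> c"
  shows "family_sup f J p \<le> c"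
  unfolding family_sup_def using assms by (intro cSup_least) auto

lemma family_sup_lipschitz:
  fixes f :: "'i \<Rightarrow> 'm::metric_space \<Rightarrow> real"
  assumes "\<And>j p. f j p \<le> 1" and "\<And>j p q. f j p \<le> f j q + L * dist p q" and "0 \<le> L"
  shows "family_sup f J p \<le> family_sup f J q + L * dist p q"
proof (rule family_sup_least)
  show "0 \<le> family_sup f J q + L * dist p q"
    using family_sup_nonneg[of f, OF assms(1)] assms(3) by (intro add_nonneg_nonneg) auto
  show "f j p \<le> family_sup f J q + L * dist p q" if "j \<in> J" for j
    using assms(2)[of j p q] family_sup_upper[of f, OF assms(1) that, of q] by linarith
qed

lemma continuous_on_one_sided_lipschitz:
  fixes f :: "'m::metric_space \<Rightarrow> real"
  assumes "\<And>p q. f p \<le> f q + L * dist p q" and "0 \<le> L"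
  shows "continuous_on S f"
proof (rule lipschitz_on_continuous_on)
  show "L-lipschitz_on S f"
  proof (rule lipschitz_onI)
    show "dist (f p) (f q) \<le> L * dist p q" for p q
      using assms(1)[of p q] assms(1)[of q p] by (simp add: dist_real_def dist_commute abs_le_iff)
  qed (rule assms(2))
qed

definition locally_finite_bumps :: "'m::metric_space set \<Rightarrow> ('m \<Rightarrow> real) \<Rightarrow> ('m \<Rightarrow> 'm \<Rightarrow> real) \<Rightarrow> bool"
  where "locally_finite_bumps P \<delta> k \<longleftrightarrow>
    (\<forall>i. continuous_on P (k i)) \<and> (\<forall>i p. 0 \<le> k i p) \<and>
    (\<forall>i p. k i p \<noteq> 0 \<longrightarrow> dist i p < \<delta> i) \<and>
    (\<forall>p\<in>P. \<exists>i\<in>P. k i p \<noteq> 0) \<and>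
    (\<forall>p\<in>P. \<exists>r>0. finite {i \<in> P. \<exists>q\<in>P \<inter> ball p r. k i q \<noteq> 0})"

text \<open>Metric spaces admit locally finite partitions of unity, up to normalization. Well-order the
  index set and let \<open>h i\<close> be the amount by which the bump function \<open>f i\<close> exceeds all its predecessors.
  These functions are uniformly Lipschitz, since suprema preserve Lipschitz constants. At
  a fixed point only finitely many of them exceed a given \<open>c > 0\<close>, because each such index
  raises the supremum of the bump functions by at least \<open>c\<close>. Cutting off at
  half of the supremum of all \<open>h i\<close>, which is positive by the choice of the first nonzero bump
  function, makes the family locally finite.\<close>

lemma locally_finite_bump_functions:
  fixes P :: "'m::metric_space set" and \<delta> :: "'m \<Rightarrow> real"
  assumes \<delta>: "\<And>i. i \<in> P \<Longrightarrow> 0 < \<delta> i"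
  shows "\<exists>k. locally_finite_bumps P \<delta> k"
proof -
  define f where "f i p = max 0 (min 1 (\<delta> i) - dist i p)" for i p :: 'm
  have f0: "0 \<le> f i p" for i p by (simp add: f_def)
  have f1: "f i p \<le> 1" for i p
    unfolding f_def
    by (rule max.boundedI) (use zero_le_dist[of i p] min.cobounded1[of 1 "\<delta> i"] in linarith)+
  have fL: "f i p \<le> f i q + 1 * dist p q" for i p q
    using dist_triangle[of i q p] by (auto simp: f_def dist_commute)
  have f_pos: "dist i p < \<delta> i" if "0 < f i p" for i p
    using that by (auto simp: f_def split: if_splits)
  obtain r :: "'m rel" where "Well_order r" "Field r = UNIV"
    using well_ordering[where 'a = 'm] by (elim exE conjE)
  then have tot: "(i, j) \<in> r \<or> (j, i) \<in> r" if "i \<noteq> j" for i j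
    using that by (auto simp: well_order_on_def linear_order_on_def total_on_def)
  have wf: "wf (r - Id)" using \<open>Well_order r\<close> by (simp add: well_order_on_def)
  have trans: "trans r"
    using \<open>Well_order r\<close>
    by (auto simp: well_order_on_def linear_order_on_def partial_order_on_def preorder_on_def)
  define J where "J i = {j \<in> P. (j, i) \<in> r - Id}" for i
  define h where "h i p = max 0 (f i p - family_sup f (J i) p)" for i p
  have hf: "h i p \<le> f i p" for i p
    using family_sup_nonneg[of f, OF f1, of "J i" p] f0[of i p] by (auto simp: h_def)
  have h1: "h i p \<le> 1" for i p using hf f1 order_trans by blast
  have hL: "h i p \<le> h i q + 2 * dist p q" for i p q
    using fL[of i p q] family_sup_lipschitz[of f 1, OF f1 fL, of "J i" q p]
    by (auto simp: h_def dist_commute)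
  define m where "m p = family_sup h P p" for p
  have m0: "0 \<le> m p" for p unfolding m_def by (rule family_sup_nonneg[of h, OF h1])
  have mL: "m p \<le> m q + 2 * dist p q" for p q
    unfolding m_def by (rule family_sup_lipschitz[of h 2, OF h1 hL]) simp
  have m_pos: "0 < m p" if "p \<in> P" for p
  proof -
    have "p \<in> {i \<in> P. 0 < f i p}" using that \<delta>[OF that] by (simp add: f_def)
    with wf have "\<exists>i\<in>{i \<in> P. 0 < f i p}. \<forall>j. (j, i) \<in> r - Id \<longrightarrow> j \<notin> {i \<in> P. 0 < f i p}"
      unfolding wf_eq_minimal by meson
    then obtain i
      where i: "i \<in> P" "0 < f i p" "\<forall>j. (j, i) \<in> r - Id \<longrightarrow> j \<notin> {i \<in> P. 0 < f i p}"
      by auto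
    have "family_sup f (J i) p \<le> 0"
      using i(3) by (intro family_sup_least) (auto simp: J_def not_less)
    then have "0 < h i p" using i(2) by (simp add: h_def)
    also have "\<dots> \<le> m p" unfolding m_def by (rule family_sup_upper[of h, OF h1 i(1)])
    finally show ?thesis .
  qed
  \<comment> \<open>Listing \<open>F\<close> in increasing order, every index raises the supremum of the \<open>f i p\<close> by more than \<open>c\<close>.\<close>
  have count: "c * real (card F) \<le> family_sup f F p"
    if "finite F" "F \<subseteq> {i \<in> P. c < h i p}" "0 < c" for F c p
    using that
  proof (induction "card F" arbitrary: F)
    case 0
    then show ?case using family_sup_nonneg[of f, OF f1] by simp
  next
    case (Suc n)
    have "\<exists>i\<in>F. \<forall>j\<in>F. (j, i) \<in> r \<or> j = i" if "finite F" "F \<noteq> {}" for F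
      using that
    proof (induction rule: finite_ne_induct)
      case (insert x F)
      then obtain i where i: "i \<in> F" "\<forall>j\<in>F. (j, i) \<in> r \<or> j = i" by blast
      show ?case
      proof (cases "(x, i) \<in> r \<or> x = i")
        case True
        then show ?thesis using i by blast
      next
        case False
        then have "(i, x) \<in> r" using tot by blast
        then have "\<forall>j\<in>insert x F. (j, x) \<in> r \<or> j = x"
          using i(2) trans by (metis insert_iff transD)
        then show ?thesis by blast
      qed
    qed simp
    moreover have "F \<noteq> {}" using Suc(2) by auto
    ultimately obtain i where i: "i \<in> F" "\<forall>j\<in>F. (j, i) \<in> r \<or> j = i"
      using Suc.prems(1) by blast
    have "c * real (card (F - {i})) \<le> family_sup f (F - {i}) p"
      using Suc i(1) by (intro Suc(1)) auto
    also have "\<dots> \<le> family_sup f (J i) p"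
      using Suc.prems(2) i(2)
      by (intro family_sup_least family_sup_nonneg[of f, OF f1] family_sup_upper[of f, OF f1])
         (auto simp: J_def)
    also have "\<dots> \<le> f i p - c"
    proof -
      have "c < h i p" using i(1) Suc.prems(2) by blast
      then show ?thesis using \<open>0 < c\<close> by (simp add: h_def split: if_splits)
    qed
    also have "\<dots> \<le> family_sup f F p - c"
      using family_sup_upper[of f, OF f1 i(1)] by simp
    finally have "c * real (card (F - {i})) + c \<le> family_sup f F p" by simp
    moreover have "real (card F) = real (card (F - {i})) + 1"
      using card_Suc_Diff1[OF Suc.prems(1) i(1)] by (metis of_nat_Suc add.commute)
    ultimately show ?case by (simp add: distrib_left)
  qed
  have fin: "finite {i \<in> P. c < h i p}" if "0 < c" for c p
  proof (rule ccontr)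
    assume inf: "infinite {i \<in> P. c < h i p}"
    obtain n :: nat where n: "1 / c < real n" using reals_Archimedean2 by blast
    obtain F where F: "finite F" "card F = n" "F \<subseteq> {i \<in> P. c < h i p}"
      using infinite_arbitrarily_large[OF inf] by blast
    have "c * real n \<le> family_sup f F p" using count[OF F(1,3) that] F(2) by simp
    also have "\<dots> \<le> 1" by (intro family_sup_least f1) simp
    finally show False using n that by (simp add: field_simps)
  qed
  define k where "k i p = max 0 (h i p - m p / 2)" for i p
  show ?thesis
    unfolding locally_finite_bumps_def
  proof (intro exI[of _ k] conjI allI ballI impI)
    show "continuous_on P (k i)" for i
      unfolding k_def
      by (intro continuous_intros continuous_on_one_sided_lipschitz[of _ 2] hL mL) simp_all
    show "0 \<le> k i p" for i p by (simp add: k_def)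
    show "dist i p < \<delta> i" if "k i p \<noteq> 0" for i p
    proof -
      have "0 < h i p" using that m0[of p] by (auto simp: k_def max_def split: if_splits)
      then show ?thesis using hf[of i p] f_pos by (meson order_less_le_trans)
    qed
    show "\<exists>i\<in>P. k i p \<noteq> 0" if "p \<in> P" for p
    proof (rule ccontr)
      assume "\<not> (\<exists>i\<in>P. k i p \<noteq> 0)"
      then have "h i p \<le> m p / 2" if "i \<in> P" for i
        using that by (auto simp: k_def max_def split: if_splits)
      then have "m p \<le> m p / 2"
        using m0[of p] unfolding m_def by (intro family_sup_least) auto
      then show False using m_pos[OF that] by simp
    qed
    show "\<exists>r>0. finite {i \<in> P. \<exists>q\<in>P \<inter> ball p r. k i q \<noteq> 0}" if "p \<in> P" for p
    proof (intro exI conjI)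
      \<comment> \<open>On this ball \<open>h i\<close> changes by \<open>m p / 6\<close> and \<open>m / 2\<close> by \<open>m p / 12\<close>, in total by half of \<open>m p / 2\<close>.\<close>
      show "0 < m p / 12" using m_pos[OF that] by simp
      have "m p / 4 < h i p" if "dist p q < m p / 12" "k i q \<noteq> 0" for i q
      proof -
        have "m q / 2 < h i q" using that(2) by (auto simp: k_def max_def split: if_splits)
        then show ?thesis using that(1) hL[of i q p] mL[of p q] by (simp add: dist_commute)
      qed
      then have "{i \<in> P. \<exists>q\<in>P \<inter> ball p (m p / 12). k i q \<noteq> 0} \<subseteq> {i \<in> P. m p / 4 < h i p}"
        by auto
      then show "finite {i \<in> P. \<exists>q\<in>P \<inter> ball p (m p / 12). k i q \<noteq> 0}"
        by (rule finite_subset[OF _ fin]) (use m_pos[OF that] in simp)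
    qed
  qed
qed

lemma continuous_on_locally:
  fixes P :: "'m::metric_space set"
  assumes "\<And>p. p \<in> P \<Longrightarrow> \<exists>r>0. continuous_on (P \<inter> ball p r) A"
  shows "continuous_on P A"
  unfolding continuous_on_eq_continuous_within
proof
  fix p assume p: "p \<in> P"
  then obtain r where r: "0 < r" "continuous_on (P \<inter> ball p r) A" using assms by blast
  then have "continuous (at p within P \<inter> ball p r) A"
    using p by (simp add: continuous_on_eq_continuous_within)
  moreover have "at p within P \<inter> ball p r = at p within P"
    using r(1) by (intro at_within_nhd[of p "ball p r"]) auto
  ultimately show "continuous (at p within P) A" by simp
qed

text \<open>Convex combinations with the normalized bump functions as coefficients select from \<open>\<phi>\<close>.
  The local selection around \<open>i\<close> is only used where the bump function for half of its radius
  does not vanish, so that the product extends continuously by \<open>0\<close>.\<close>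

lemma glue_convex_selections:
  fixes P :: "'m::metric_space set" and \<phi> :: "'m \<Rightarrow> 'e::real_normed_vector set"
  assumes convex: "\<And>p. p \<in> P \<Longrightarrow> convex (\<phi> p)"
    and local_sel: "\<And>p. p \<in> P \<Longrightarrow>
      \<exists>r>0. \<exists>g. continuous_on (P \<inter> ball p r) g \<and> (\<forall>q\<in>P \<inter> ball p r. g q \<in> \<phi> q)"
  shows "\<exists>A. continuous_on P A \<and> (\<forall>p\<in>P. A p \<in> \<phi> p)"
proof -
  obtain \<rho> g where \<rho>: "\<And>i. i \<in> P \<Longrightarrow> 0 < \<rho> i"
    and g: "\<And>i. i \<in> P \<Longrightarrow> continuous_on (P \<inter> ball i (\<rho> i)) (g i)"
    and g\<phi>: "\<And>i q. i \<in> P \<Longrightarrow> q \<in> P \<inter> ball i (\<rho> i) \<Longrightarrow> g i q \<in> \<phi> q"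
    using local_sel by metis
  have "0 < \<rho> i / 2" if "i \<in> P" for i using \<rho>[OF that] by simp
  from locally_finite_bump_functions[of P "\<lambda>i. \<rho> i / 2", OF this]
  obtain k where "locally_finite_bumps P (\<lambda>i. \<rho> i / 2) k"
    by blast
  then have k: "\<And>i. continuous_on P (k i)" "\<And>i p. 0 \<le> k i p"
      and supp: "\<And>i p. k i p \<noteq> 0 \<Longrightarrow> dist i p < \<rho> i / 2"
      and ex: "\<And>p. p \<in> P \<Longrightarrow> \<exists>i\<in>P. k i p \<noteq> 0"
      and fin: "\<And>p. p \<in> P \<Longrightarrow> \<exists>r>0. finite {i \<in> P. \<exists>q\<in>P \<inter> ball p r. k i q \<noteq> 0}"
    unfolding locally_finite_bumps_def by simp_all
  define I where "I p = {i \<in> P. k i p \<noteq> 0}" for p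
  define K where "K p = (\<Sum>i\<in>I p. k i p)" for p
  define A where "A p = (\<Sum>i\<in>I p. (k i p / K p) *\<^sub>R g i p)" for p
  have fin_I: "finite (I p)" if "p \<in> P" for p
  proof -
    obtain r where "0 < r" "finite {i \<in> P. \<exists>q\<in>P \<inter> ball p r. k i q \<noteq> 0}" using fin[OF \<open>p \<in> P\<close>] by blast
    then show ?thesis
      using that by (elim finite_subset[rotated]) (auto simp: I_def)
  qed
  have K_pos: "0 < K p" if p: "p \<in> P" for p
  proof -
    obtain i where "i \<in> P" "k i p \<noteq> 0" using ex[OF p] by blast
    then show ?thesis
      unfolding K_def using fin_I[OF p] k(2)[of _ p]
      by (intro sum_pos2[of _ i]) (auto simp: I_def order_less_le)
  qed
  have "A p \<in> \<phi> p" if "p \<in> P" for p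
    unfolding A_def
  proof (rule convex_sum[OF fin_I[OF that] convex[OF that]])
    show "(\<Sum>i\<in>I p. k i p / K p) = 1"
      using K_pos[OF that] by (simp flip: sum_divide_distrib K_def)
    show "0 \<le> k i p / K p" for i using K_pos[OF that] k(2) by simp
    show "g i p \<in> \<phi> p" if i: "i \<in> I p" for i
    proof (rule g\<phi>)
      show "i \<in> P" using i by (simp add: I_def)
      then show "p \<in> P \<inter> ball i (\<rho> i)"
        using \<open>p \<in> P\<close> supp[of i p] i \<rho>[of i] by (auto simp: I_def)
    qed
  qed
  moreover have "continuous_on P A"
  proof (rule continuous_on_locally)
    fix p assume p: "p \<in> P"
    obtain r where r: "0 < r" "finite {i \<in> P. \<exists>q\<in>P \<inter> ball p r. k i q \<noteq> 0}"
      using fin[OF p] by blast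
    define F where "F = {i \<in> P. \<exists>q\<in>P \<inter> ball p r. k i q \<noteq> 0}"
    have F: "finite F" "F \<subseteq> P" using r by (auto simp: F_def)
    have sum_F: "(\<Sum>i\<in>I q. u i) = (\<Sum>i\<in>F. u i)"
      if "q \<in> P \<inter> ball p r" and "\<And>i. k i q = 0 \<Longrightarrow> u i = 0" for q and u :: "'m \<Rightarrow> 'v::comm_monoid_add"
      using that F by (intro sum.mono_neutral_left) (auto simp: I_def F_def)
    have kg: "continuous_on P (\<lambda>q. k i q *\<^sub>R g i q)" if "i \<in> P" for i
    proof -
      let ?S = "P \<inter> ball i (\<rho> i)" and ?T = "P \<inter> - cball i (\<rho> i / 2)"
      have "continuous_on (?S \<union> ?T) (\<lambda>q. k i q *\<^sub>R g i q)"
      proof (rule continuous_on_Un_local_open)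
        show "openin (top_of_set (?S \<union> ?T)) ?S" "openin (top_of_set (?S \<union> ?T)) ?T"
          unfolding openin_open by (rule exI[of _ "ball i (\<rho> i)"], auto)
        show "continuous_on ?S (\<lambda>q. k i q *\<^sub>R g i q)"
          using g[OF that] k(1)[of i] by (intro continuous_intros) (auto elim: continuous_on_subset)
        show "continuous_on ?T (\<lambda>q. k i q *\<^sub>R g i q)"
        proof (rule continuous_on_eq[OF continuous_on_const[of _ 0]])
          show "0 = k i q *\<^sub>R g i q" if "q \<in> ?T" for q using that supp[of i q] by auto
        qed
      qed
      moreover have "?S \<union> ?T = P" using \<rho>[OF that] by auto
      ultimately show ?thesis by simp
    qed
    have KF: "(\<Sum>i\<in>F. k i q) = K q" if "q \<in> P \<inter> ball p r" for q
      unfolding K_def by (simp add: sum_F[OF that])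
    have "continuous_on (P \<inter> ball p r) (\<lambda>q. \<Sum>i\<in>F. k i q *\<^sub>R g i q)"
      using F(2) by (intro continuous_on_sum continuous_on_subset[OF kg]) auto
    moreover have "continuous_on (P \<inter> ball p r) (\<lambda>q. \<Sum>i\<in>F. k i q)"
      by (intro continuous_on_sum continuous_on_subset[OF k(1)]) auto
    moreover have "(\<Sum>i\<in>F. k i q) \<noteq> 0" if "q \<in> P \<inter> ball p r" for q
      using K_pos[of q] that unfolding KF[OF that] by simp
    ultimately have "continuous_on (P \<inter> ball p r) (\<lambda>q. (1 / (\<Sum>i\<in>F. k i q)) *\<^sub>R (\<Sum>i\<in>F. k i q *\<^sub>R g i q))"
      by (intro continuous_on_scaleR continuous_on_divide continuous_on_const ballI)
    moreover have "(1 / (\<Sum>i\<in>F. k i q)) *\<^sub>R (\<Sum>i\<in>F. k i q *\<^sub>R g i q) = A q" if "q \<in> P \<inter> ball p r" for q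
    proof -
      have "(\<Sum>i\<in>F. k i q *\<^sub>R g i q) = (\<Sum>i\<in>I q. k i q *\<^sub>R g i q)"
        by (simp add: sum_F[OF that])
      then show ?thesis by (simp add: KF[OF that] A_def scaleR_sum_right)
    qed
    ultimately have "continuous_on (P \<inter> ball p r) A"
      by (rule continuous_on_eq)
    then show "\<exists>r>0. continuous_on (P \<inter> ball p r) A" using r(1) by blast
  qed
  ultimately show ?thesis by blast
qed


section \<open>From approximate to exact continuous solutions\<close>

context cstar_representation
begin

lemma bounded_bilinear_rep: "bounded_bilinear \<pi>"
  using rep_contractive
  by (intro bounded_bilinear.intro exI[of _ 1])
     (auto simp: rep_add rep_add_right rep_scaleR rep_scaleR_right)

lemma bounded_bilinear_rep_tuple:
  "bounded_bilinear (rep_tuple :: 'a \<Rightarrow> 'h ^ 'n::finite \<Rightarrow> 'h ^ 'n)"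
  by (rule cstar_representation.bounded_bilinear_rep[OF rep_tuple_representation])

lemmas continuous_on_rep_tuple [continuous_intros] =
  bounded_bilinear.continuous_on[OF bounded_bilinear_rep_tuple]

text \<open>Away from \<open>z = 0\<close>, a solution that is approximate at one point remains so nearby, and
  approximate solutions subject to a norm bound form a convex set; relaxing the error from
  \<open>1/4\<close> to \<open>1/2\<close> and the constant from \<open>C\<close> to \<open>B\<close> makes the conditions open. Glued constants therefore
  give a continuous approximate solution, which the norm bound extends by \<open>0\<close> to \<open>z = 0\<close>.\<close>

lemma continuous_approximate_solution:
  fixes Q :: "(('h ^ 'n::finite) \<times> ('h ^ 'n)) set"
  assumes E: "subspace E"
    and near: "\<And>x z. (x, z) \<in> Q \<Longrightarrow>
      \<exists>a\<in>E. norm a \<le> C * norm z \<and> norm (rep_tuple a x - z) \<le> norm z / 4"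
  obtains g B where "continuous_on Q g" and "0 \<le> B" and "\<And>p. p \<in> Q \<Longrightarrow> g p \<in> E"
    and "\<And>p. p \<in> Q \<Longrightarrow> norm (g p) \<le> B * norm (snd p)"
    and "\<And>p. p \<in> Q \<Longrightarrow> norm (rep_tuple (g p) (fst p) - snd p) \<le> norm (snd p) / 2"
proof -
  interpret T: cstar_representation "rep_tuple :: 'a \<Rightarrow> 'h ^ 'n \<Rightarrow> 'h ^ 'n"
    by (rule rep_tuple_representation)
  define B where "B = \<bar>C\<bar> + 1"
  define \<psi> where "\<psi> p = {a \<in> E. norm a \<le> B * norm (snd p) \<and>
    norm (rep_tuple a (fst p) - snd p) \<le> norm (snd p) / 2}" for p :: "('h ^ 'n) \<times> ('h ^ 'n)"
  define Q' where "Q' = {p \<in> Q. snd p \<noteq> 0}"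
  have "\<exists>g. continuous_on Q' g \<and> (\<forall>p\<in>Q'. g p \<in> \<psi> p)"
  proof (rule glue_convex_selections)
    fix p
    have "\<psi> p = E \<inter> cball 0 (B * norm (snd p))
        \<inter> ((\<lambda>a. rep_tuple a (fst p)) -` cball (snd p) (norm (snd p) / 2))"
      by (auto simp: \<psi>_def dist_norm norm_minus_commute)
    then show "convex (\<psi> p)"
      by (simp only:) (intro convex_Int subspace_imp_convex[OF E] convex_cball
          convex_linear_vimage bounded_linear.linear[OF T.rep_bounded_linear_left])
  next
    fix p assume p: "p \<in> Q'"
    then have nz: "0 < norm (snd p)" by (simp add: Q'_def)
    obtain a where a: "a \<in> E" "norm a \<le> C * norm (snd p)"
      "norm (rep_tuple a (fst p) - snd p) \<le> norm (snd p) / 4"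
      using near[of "fst p" "snd p"] p by (auto simp: Q'_def)
    have "C * norm (snd p) < B * norm (snd p)"
      using nz by (intro mult_strict_right_mono) (auto simp: B_def)
    define U :: "(('h ^ 'n) \<times> ('h ^ 'n)) set" where "U = {q. norm a < B * norm (snd q) \<and>
      norm (rep_tuple a (fst q) - snd q) < norm (snd q) / 2}"
    have "open U"
      unfolding U_def
      by (intro open_Collect_conj open_Collect_less continuous_intros) simp
    moreover have "p \<in> U"
      using a \<open>C * norm (snd p) < B * norm (snd p)\<close> nz
      unfolding U_def by (intro CollectI conjI) linarith+
    ultimately obtain r where r: "0 < r" "ball p r \<subseteq> U"
      using open_contains_ball by blast
    show "\<exists>r>0. \<exists>g. continuous_on (Q' \<inter> ball p r) g \<and> (\<forall>q\<in>Q' \<inter> ball p r. g q \<in> \<psi> q)"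
    proof (intro exI conjI ballI)
      show "0 < r" by (rule r)
      show "continuous_on (Q' \<inter> ball p r) (\<lambda>_. a)" by (rule continuous_on_const)
      show "a \<in> \<psi> q" if "q \<in> Q' \<inter> ball p r" for q
        using that r(2) a(1) by (auto simp: \<psi>_def U_def)
    qed
  qed
  then obtain g0 where g0: "continuous_on Q' g0" "\<And>p. p \<in> Q' \<Longrightarrow> g0 p \<in> \<psi> p" by blast
  define g where "g p = (if snd p = 0 then 0 else g0 p)" for p
  have g: "g p \<in> \<psi> p" if "p \<in> Q" for p
    using that g0(2)[of p] subspace_0[OF E]
    by (cases "snd p = 0") (auto simp: g_def \<psi>_def Q'_def T.rep_zero)
  have "continuous_on Q g"
    unfolding continuous_on_eq_continuous_within
  proof
    fix p assume p: "p \<in> Q"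
    show "continuous (at p within Q) g"
    proof (cases "snd p = 0")
      case True
      have "((\<lambda>q. B * norm (snd q)) \<longlongrightarrow> B * norm (snd p)) (at p within Q)"
        by (intro tendsto_intros)
      then have "((\<lambda>q. B * norm (snd q)) \<longlongrightarrow> 0) (at p within Q)" using True by simp
      moreover have "eventually (\<lambda>q. norm (g q) \<le> B * norm (snd q)) (at p within Q)"
        using g by (auto simp: eventually_at_filter \<psi>_def)
      ultimately have "(g \<longlongrightarrow> 0) (at p within Q)" by (rule Lim_null_comparison[rotated])
      then show ?thesis using True by (simp add: continuous_within g_def)
    next
      case False
      let ?U = "{q :: ('h ^ 'n) \<times> ('h ^ 'n). snd q \<noteq> 0}"
      have "open ?U" by (intro open_Collect_neq continuous_intros)
      have "continuous_on Q' g"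
        by (rule continuous_on_eq[OF g0(1)]) (simp add: g_def Q'_def)
      moreover have "p \<in> Q'" using p False by (simp add: Q'_def)
      ultimately have "continuous (at p within Q') g"
        unfolding continuous_on_eq_continuous_within by blast
      moreover have "at p within Q' = at p within Q"
        using False \<open>open ?U\<close> by (intro at_within_nhd[of p ?U]) (auto simp: Q'_def)
      ultimately show ?thesis by simp
    qed
  qed
  then show thesis
    by (rule that[of g B]) (use g in \<open>auto simp: \<psi>_def B_def\<close>)
qed

text \<open>Correcting the error of the approximate solution again and again halves it each time, and
  the corrections form a series that converges uniformly when the right-hand sides are bounded by \<open>R\<close>.\<close>

lemma continuous_exact_solution_bounded:
  fixes Q :: "(('h ^ 'n::finite) \<times> ('h ^ 'n)) set"
  assumes E: "subspace E" "closed E"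
    and near: "\<And>x z. (x, z) \<in> Q \<Longrightarrow>
      \<exists>a\<in>E. norm a \<le> C * norm z \<and> norm (rep_tuple a x - z) \<le> norm z / 4"
    and residual: "\<And>x z a. (x, z) \<in> Q \<Longrightarrow> a \<in> E \<Longrightarrow> norm (z - rep_tuple a x) \<le> norm z \<Longrightarrow>
      (x, z - rep_tuple a x) \<in> Q"
    and R: "\<And>x z. (x, z) \<in> Q \<Longrightarrow> norm z \<le> R"
  shows "\<exists>A. continuous_on Q A \<and> (\<forall>p\<in>Q. A p \<in> E \<and> rep_tuple (A p) (fst p) = snd p)"
proof -
  interpret T: cstar_representation "rep_tuple :: 'a \<Rightarrow> 'h ^ 'n \<Rightarrow> 'h ^ 'n"
    by (rule rep_tuple_representation)
  obtain g B where g: "continuous_on Q g" "0 \<le> B" "\<And>p. p \<in> Q \<Longrightarrow> g p \<in> E"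
    "\<And>p. p \<in> Q \<Longrightarrow> norm (g p) \<le> B * norm (snd p)"
    "\<And>p. p \<in> Q \<Longrightarrow> norm (rep_tuple (g p) (fst p) - snd p) \<le> norm (snd p) / 2"
    using continuous_approximate_solution[OF E(1) near] by metis
  define step where "step p = (fst p, snd p - rep_tuple (g p) (fst p))" for p
  define Z where "Z k = step ^^ k" for k
  have Z [simp]: "Z 0 p = p" "Z (Suc k) p = step (Z k p)" for k p by (simp_all add: Z_def)
  have fst_Z: "fst (Z k p) = fst p" for k p by (induction k) (simp_all add: step_def)
  have step: "step p \<in> Q" "norm (snd (step p)) \<le> norm (snd p) / 2" if "p \<in> Q" for p
  proof -
    have *: "norm (snd p - rep_tuple (g p) (fst p)) \<le> norm (snd p) / 2"
      using g(5)[OF that] by (simp add: norm_minus_commute)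
    then show "norm (snd (step p)) \<le> norm (snd p) / 2" by (simp add: step_def)
    have "norm (snd p - rep_tuple (g p) (fst p)) \<le> norm (snd p)"
      using * norm_ge_zero[of "snd p"] by linarith
    then show "step p \<in> Q"
      unfolding step_def using residual[of "fst p" "snd p" "g p"] that g(3) by simp
  qed
  have ZQ: "Z k p \<in> Q" if "p \<in> Q" for k p
    by (induction k) (use that step in auto)
  have Z_small: "norm (snd (Z k p)) \<le> R * (1/2) ^ k" if "p \<in> Q" for k p
  proof (induction k)
    case 0
    then show ?case using R[of "fst p" "snd p"] that by simp
  next
    case (Suc k)
    then show ?case using step(2)[OF ZQ[OF that, of k]] by simp
  qed
  have Z_cont: "continuous_on Q (Z k)" for k
  proof (induction k)
    case 0
    then show ?case by (simp add: Z_def continuous_on_id)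
  next
    case (Suc k)
    have "continuous_on Q step"
      unfolding step_def by (intro continuous_intros g)
    then have "continuous_on Q (step \<circ> Z k)"
      using Suc ZQ by (intro continuous_on_compose) (auto elim: continuous_on_subset)
    then show ?case by (simp add: Z_def)
  qed
  define S where "S n p = (\<Sum>k<n. g (Z k p))" for n p
  define A where "A p = (\<Sum>k. g (Z k p))" for p
  have bound: "norm (g (Z k p)) \<le> (B * R) * (1/2) ^ k" if "p \<in> Q" for k p
  proof -
    have "norm (g (Z k p)) \<le> B * norm (snd (Z k p))" by (intro g ZQ that)
    also have "\<dots> \<le> B * (R * (1/2) ^ k)" using Z_small[OF that] g(2) by (intro mult_left_mono)
    finally show ?thesis by simp
  qed
  have unif: "uniform_limit Q S A sequentially"
    unfolding S_def A_def
    by (rule Weierstrass_m_test[OF bound]) (simp_all add: summable_mult summable_geometric)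
  have "continuous_on Q A"
  proof (rule uniform_limit_theorem[OF _ unif])
    have "continuous_on Q (\<lambda>p. g (Z k p))" for k
      by (rule continuous_on_compose2[OF g(1) Z_cont]) (use ZQ in blast)
    then show "\<forall>\<^sub>F n in sequentially. continuous_on Q (S n)"
      unfolding S_def by (intro always_eventually allI continuous_on_sum)
  qed simp
  moreover have "A p \<in> E \<and> rep_tuple (A p) (fst p) = snd p" if p: "p \<in> Q" for p
  proof
    have lim: "(\<lambda>n. S n p) \<longlonglongrightarrow> A p" using tendsto_uniform_limitI[OF unif p] .
    have "S n p \<in> E" for n
      unfolding S_def by (intro subspace_sum E g ZQ p)
    then show "A p \<in> E" by (intro closed_sequentially[OF E(2) _ lim]) simp
    have residue: "rep_tuple (S n p) (fst p) = snd p - snd (Z n p)" for n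
      by (induction n) (simp_all add: S_def T.rep_zero T.rep_add step_def fst_Z)
    have "(\<lambda>n. snd (Z n p)) \<longlonglongrightarrow> 0"
    proof (rule Lim_null_comparison)
      show "\<forall>\<^sub>F n in sequentially. norm (snd (Z n p)) \<le> R * (1/2) ^ n"
        using Z_small[OF p] by simp
      show "(\<lambda>n. R * (1/2) ^ n) \<longlonglongrightarrow> 0"
        by (intro tendsto_mult_right_zero LIMSEQ_power_zero) simp
    qed
    then have "(\<lambda>n. snd p - snd (Z n p)) \<longlonglongrightarrow> snd p - 0" by (intro tendsto_intros)
    moreover have "(\<lambda>n. rep_tuple (S n p) (fst p)) \<longlonglongrightarrow> rep_tuple (A p) (fst p)"
      by (rule bounded_linear.tendsto[OF T.rep_bounded_linear_left lim])
    ultimately show "rep_tuple (A p) (fst p) = snd p"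
      unfolding residue using LIMSEQ_unique by fastforce
  qed
  ultimately show ?thesis by blast
qed

text \<open>Near each datum the constants are uniform and the right-hand sides bounded, so the preceding
  lemma gives a local solution. Exact solutions form a convex set and can be glued.\<close>

lemma continuous_exact_solution:
  fixes D :: "(('h ^ 'n::finite) \<times> ('h ^ 'n)) set"
  assumes E: "subspace E" "closed E"
    and residual: "\<And>x z a. (x, z) \<in> D \<Longrightarrow> a \<in> E \<Longrightarrow> (x, z - rep_tuple a x) \<in> D"
    and near: "\<And>x0 y0. (x0, y0) \<in> D \<Longrightarrow> \<exists>C. \<exists>\<delta>>0. \<forall>x z. (x, z) \<in> D \<longrightarrow> norm (x - x0) < \<delta> \<longrightarrow>
      (\<exists>a\<in>E. norm a \<le> C * norm z \<and> norm (rep_tuple a x - z) \<le> norm z / 4)"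
  shows "\<exists>A. continuous_on D A \<and> (\<forall>p\<in>D. A p \<in> {a \<in> E. rep_tuple a (fst p) = snd p})"
proof (rule glue_convex_selections)
  interpret T: cstar_representation "rep_tuple :: 'a \<Rightarrow> 'h ^ 'n \<Rightarrow> 'h ^ 'n"
    by (rule rep_tuple_representation)
  fix p :: "('h ^ 'n) \<times> ('h ^ 'n)"
  show "convex {a \<in> E. rep_tuple a (fst p) = snd p}"
    unfolding convex_def
  proof (intro ballI allI impI)
    fix a b and u v :: real
    assume ab: "a \<in> {a \<in> E. rep_tuple a (fst p) = snd p}" "b \<in> {a \<in> E. rep_tuple a (fst p) = snd p}"
      and uv: "0 \<le> u" "0 \<le> v" "u + v = 1"
    have "rep_tuple (u *\<^sub>R a + v *\<^sub>R b) (fst p) = u *\<^sub>R rep_tuple a (fst p) + v *\<^sub>R rep_tuple b (fst p)"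
      by (simp only: T.rep_add T.rep_scaleR)
    also have "\<dots> = (u + v) *\<^sub>R snd p" using ab by (simp add: scaleR_add_left)
    finally show "u *\<^sub>R a + v *\<^sub>R b \<in> {a \<in> E. rep_tuple a (fst p) = snd p}"
      using E(1) ab uv by (simp add: subspace_add subspace_scale)
  qed
next
  fix p assume "p \<in> D"
  define x0 y0 where "x0 = fst p" and "y0 = snd p"
  obtain C \<delta> where \<delta>: "0 < \<delta>"
    and C: "\<And>x z. (x, z) \<in> D \<Longrightarrow> norm (x - x0) < \<delta> \<Longrightarrow>
      \<exists>a\<in>E. norm a \<le> C * norm z \<and> norm (rep_tuple a x - z) \<le> norm z / 4"
    using near[of x0 y0] \<open>p \<in> D\<close> by (auto simp: x0_def y0_def)
  define Q where "Q = {q \<in> D. norm (fst q - x0) < \<delta> \<and> norm (snd q) \<le> norm y0 + 1}"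
  have "\<exists>A. continuous_on Q A \<and> (\<forall>q\<in>Q. A q \<in> E \<and> rep_tuple (A q) (fst q) = snd q)"
    using C residual
    by (intro continuous_exact_solution_bounded[OF E, of Q C "norm y0 + 1"]) (auto simp: Q_def)
  then obtain A where A: "continuous_on Q A" "\<And>q. q \<in> Q \<Longrightarrow> A q \<in> E \<and> rep_tuple (A q) (fst q) = snd q"
    by blast
  have sub: "D \<inter> ball p (min \<delta> 1) \<subseteq> Q"
  proof
    fix q assume q: "q \<in> D \<inter> ball p (min \<delta> 1)"
    have "dist (fst q) x0 \<le> dist q p" "dist (snd q) y0 \<le> dist q p"
      unfolding x0_def y0_def by (rule dist_fst_le dist_snd_le)+
    moreover have "norm (snd q) \<le> norm y0 + dist (snd q) y0"
      using norm_triangle_ineq[of y0 "snd q - y0"] by (simp add: dist_norm)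
    ultimately show "q \<in> Q" using q by (auto simp: Q_def dist_norm dist_commute norm_minus_commute)
  qed
  show "\<exists>r>0. \<exists>g. continuous_on (D \<inter> ball p r) g
      \<and> (\<forall>q\<in>D \<inter> ball p r. g q \<in> {a \<in> E. rep_tuple a (fst q) = snd q})"
  proof (intro exI conjI ballI)
    show "0 < min \<delta> 1" using \<delta> by simp
    show "continuous_on (D \<inter> ball p (min \<delta> 1)) A" using A(1) sub by (rule continuous_on_subset)
    show "A q \<in> {a \<in> E. rep_tuple a (fst q) = snd q}" if "q \<in> D \<inter> ball p (min \<delta> 1)" for q
      using A(2)[of q] sub that by blast
  qed
qed

end


section \<open>Continuous interpolation\<close>

theorem theorem3p5:
  fixes \<pi> :: "'a::cstar_algebra \<Rightarrow> 'h::chilbert_space \<Rightarrow> 'h"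
  assumes "irreducible_representation \<pi>"
    and "\<exists>a x. \<pi> a x \<noteq> 0"
  shows "(\<exists>A :: ('h ^ 'n::finite) \<times> ('h ^ 'n) \<Rightarrow> 'a.
            continuous_on interp_data A \<and>
            (\<forall>(x, y) \<in> interp_data. \<forall>i. \<pi> (A (x, y)) (x $ i) = y $ i)) \<and>
         (\<exists>A :: ('h ^ 'n) \<times> ('h ^ 'n) \<Rightarrow> 'a.
            continuous_on interp_data_sa A \<and>
            A ` interp_data_sa \<subseteq> selfadjoint_elements \<and>
            (\<forall>(x, y) \<in> interp_data_sa. \<forall>i. \<pi> (A (x, y)) (x $ i) = y $ i))"
proof -
  interpret nonzero_irreducible_representation \<pi>
    using assms by (intro nonzero_irreducible_representation.intro
        nonzero_irreducible_representation_axioms.intro)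
  let ?D = "interp_data :: (('h ^ 'n) \<times> ('h ^ 'n)) set"
  let ?S = "interp_data_sa :: (('h ^ 'n) \<times> ('h ^ 'n)) set"
  have "\<exists>A. continuous_on ?D A \<and> (\<forall>p\<in>?D. A p \<in> {a \<in> UNIV. rep_tuple a (fst p) = snd p})"
  proof (rule continuous_exact_solution)
    show "(x, z - rep_tuple a x) \<in> ?D" if "(x, z) \<in> ?D" for x z a
      using that by (simp add: interp_data_def)
    fix x0 y0 assume "(x0, y0) \<in> ?D"
    then have "clin_indep x0" by (simp add: interp_data_def)
    from local_near_solution[OF this] obtain C \<delta> where \<delta>: "0 < \<delta>"
      and C: "\<And>x z. norm (x - x0) < \<delta> \<Longrightarrow> \<exists>a. norm a \<le> C * norm z \<and> norm (rep_tuple a x - z) \<le> norm z / 4"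
      by blast
    show "\<exists>C. \<exists>\<delta>>0. \<forall>x z. (x, z) \<in> ?D \<longrightarrow> norm (x - x0) < \<delta> \<longrightarrow>
        (\<exists>a\<in>UNIV. norm a \<le> C * norm z \<and> norm (rep_tuple a x - z) \<le> norm z / 4)"
      by (intro exI[of _ C] exI[of _ \<delta>] conjI allI impI) (use \<delta> C in auto)
  qed simp_all
  then obtain A where A: "continuous_on ?D A" "\<And>p. p \<in> ?D \<Longrightarrow> rep_tuple (A p) (fst p) = snd p"
    by blast
  have "\<exists>A. continuous_on ?S A \<and> (\<forall>p\<in>?S. A p \<in> {a \<in> selfadjoint_elements. rep_tuple a (fst p) = snd p})"
  proof (rule continuous_exact_solution)
    show "(x, z - rep_tuple a x) \<in> ?S" if xz: "(x, z) \<in> ?S" and a: "a \<in> selfadjoint_elements" for x z a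
    proof -
      \<comment> \<open>The residual is the image of \<open>x\<close> under the self-adjoint operator \<open>T - \<pi> a\<close>.\<close>
      obtain T where T: "selfadjoint_op T" "\<And>i. T (x $ i) = z $ i"
        using xz by (auto simp: interp_data_sa_def)
      then have bT: "bounded_clinear T" and saT: "\<And>x y. cinner (T x) y = cinner x (T y)"
        by (auto simp: selfadjoint_op_def)
      obtain K where K: "\<And>v. norm (T v) \<le> norm v * K"
        using bounded_linear.bounded[OF bounded_clinearD(4)[OF bT]] by auto
      have "selfadjoint_op (\<lambda>v. T v - \<pi> a v)"
        unfolding selfadjoint_op_def bounded_clinear_def
      proof (intro conjI allI)
        show "Vector_Spaces.linear scaleC scaleC (\<lambda>v. T v - \<pi> a v)"
          by unfold_locales
             (simp_all add: bounded_clinearD[OF bT] rep_add_right rep_scaleC_right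
               complex_vector.scale_right_diff_distrib)
        have "norm (T v - \<pi> a v) \<le> (K + norm a) * norm v" for v
          using norm_triangle_ineq4[of "T v" "\<pi> a v"] K[of v] rep_contractive[of a v]
          by (simp add: algebra_simps)
        then show "\<exists>K. \<forall>v. norm (T v - \<pi> a v) \<le> K * norm v" by blast
        show "cinner (T v - \<pi> a v) w = cinner v (T w - \<pi> a w)" for v w
          using a by (simp add: cinner_algebra saT rep_star' selfadjoint_elements_def)
      qed
      moreover have "T (x $ i) - \<pi> a (x $ i) = (z - rep_tuple a x) $ i" for i
        by (simp add: T(2))
      ultimately show ?thesis
        using xz unfolding interp_data_sa_def interp_data_def by auto
    qed
    fix x0 y0 assume "(x0, y0) \<in> ?S"
    then have "clin_indep x0" by (simp add: interp_data_sa_def interp_data_def)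
    from local_near_solution_selfadjoint[OF this] obtain C \<delta> where \<delta>: "0 < \<delta>"
      and C: "\<And>x z. norm (x - x0) < \<delta> \<Longrightarrow> (\<forall>i j. cinner (z $ i) (x $ j) = cinner (x $ i) (z $ j)) \<Longrightarrow>
        \<exists>a\<in>selfadjoint_elements. norm a \<le> C * norm z \<and> norm (rep_tuple a x - z) \<le> norm z / 4"
      by blast
    have "\<forall>i j. cinner (z $ i) (x $ j) = cinner (x $ i) (z $ j)" if "(x, z) \<in> ?S" for x z
      using that unfolding interp_data_sa_def selfadjoint_op_def by auto metis
    then show "\<exists>C. \<exists>\<delta>>0. \<forall>x z. (x, z) \<in> ?S \<longrightarrow> norm (x - x0) < \<delta> \<longrightarrow>
        (\<exists>a\<in>selfadjoint_elements. norm a \<le> C * norm z \<and> norm (rep_tuple a x - z) \<le> norm z / 4)"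
      using \<delta> C by blast
  qed (simp_all add: subspace_selfadjoint_elements closed_selfadjoint_elements)
  then obtain A' where A': "continuous_on ?S A'"
    "\<And>p. p \<in> ?S \<Longrightarrow> A' p \<in> selfadjoint_elements \<and> rep_tuple (A' p) (fst p) = snd p"
    by blast
  show ?thesis
  proof (intro conjI exI)
    show "continuous_on interp_data A" "continuous_on interp_data_sa A'" by (fact A A')+
    show "\<forall>(x, y)\<in>interp_data. \<forall>i. \<pi> (A (x, y)) (x $ i) = y $ i"
      using A(2) by (force simp: vec_eq_iff)
    show "A' ` interp_data_sa \<subseteq> selfadjoint_elements" using A'(2) by blast
    show "\<forall>(x, y)\<in>interp_data_sa. \<forall>i. \<pi> (A' (x, y)) (x $ i) = y $ i"
      using A'(2) by (force simp: vec_eq_iff)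
  qed
qed

end
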